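(* Let $X$ be a centered, nondegenerate, infinitely divisible real random variable with finite variance $V>0$, with signed canonical remainder $R_X$ and $M_{R_X}(t)=\mathbb{E}e^{tR_X}\in(0,\infty]$. Then $$c_+(X)=\max\Bigl\{0,\sup_{t>0}\Psi_+(t)\Bigr\},\quad \Psi_+(t)=\frac{1-M_{R_X}(t)^{-1}}{t},$$ $$c_-(X)=\max\Bigl\{0,\sup_{t>0}\Psi_-(t)\Bigr\},\quad \Psi_-(t)=\frac{1-M_{R_X}(-t)^{-1}}{t},$$ with $1/\infty=0$. If the value on the right-hand side is finite, it is itself a feasible scale (i.e. the infimum in the definition of $c_+(X)$, respectively $c_-(X)=c_+(-X)$, is attained). Moreover, $$c_+(X)<\infty\iff\tau_+(X)>0,\qquad c_-(X)<\infty\iff\tau_-(X)>0.$$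
   Context: Let $a\ge0$ be the Gaussian variance and $\nu$ the Lévy measure of $X$, so that $$K_X(t)=\log\mathbb{E}e^{tX}=\frac{at^2}{2}+\int_{\mathbb{R}\setminus\{0\}}(e^{tx}-1-tx)\,\nu(\mathrm{d}x)\in[0,\infty],\qquad V=a+\int x^2\,\nu(\mathrm{d}x).$$ The signed canonical remainder is $R_X=BY_X$, where $Y_X$ has law $\frac1V\bigl(a\delta_0(\mathrm{d}x)+x^2\nu(\mathrm{d}x)\bigr)$ and $B\sim\operatorname{Beta}(1,2)$ (density $2(1-b)$ on $(0,1)$) is independent of $Y_X$. A number $c\ge0$ is a feasible (right) scale for $X$ if $K_X(t)\le\frac{Vt^2}{2(1-ct)}$ for every $0\le t<1/c$ (with $1/0=\infty$). Define $c_+(X)$ as the infimum of all feasible $c\ge0$ ($\inf\emptyset=\infty$), and $c_-(X)=c_+(-X)$. Define $\tau_+(X)=\sup\{t>0:K_X(t)<\infty\}\in[0,\infty]$ (equal to $0$ if the set is empty) and $\tau_-(X)=\tau_+(-X)$. *)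

theory Defs
  imports "HOL-Probability.Probability"
begin

definition infinitely_divisible :: "'a measure \<Rightarrow> ('a \<Rightarrow> real) \<Rightarrow> bool" where
  "infinitely_divisible M X \<longleftrightarrow>
     (\<forall>n::nat. 1 \<le> n \<longrightarrow> (\<exists>N. real_distribution N \<and>
        distr M borel X = distr (\<Pi>\<^sub>M i\<in>{..<n}. N) borel (\<lambda>x. \<Sum>i<n. x i)))"

text \<open>Gaussian variance \<open>a\<close> and Levy measure \<open>\<nu>\<close> of \<open>X\<close>, through the general Levy--Khintchine
  formula for the characteristic function with compensation on \<open>\<bar>x\<bar> \<le> 1\<close>.  The measure on
  \<open>\<real> - {0}\<close> is encoded as a Borel measure on \<open>\<real>\<close> that does not charge \<open>0\<close>.  Finiteness of
  \<open>\<integral> x\<^sup>2 d\<nu>\<close>, and the formula for the cumulant function of a centered \<open>X\<close> of finite variance, are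
  not part of the definition.\<close>

definition levy_characteristics :: "'a measure \<Rightarrow> ('a \<Rightarrow> real) \<Rightarrow> real \<Rightarrow> real measure \<Rightarrow> bool" where
  "levy_characteristics M X a \<nu> \<longleftrightarrow>
     0 \<le> a \<and> sets \<nu> = sets borel \<and> emeasure \<nu> {0} = 0 \<and>
     (\<integral>\<^sup>+ x. ennreal (min 1 (x\<^sup>2)) \<partial>\<nu>) < \<infinity> \<and>
     (\<exists>b::real. \<forall>u::real. char (distr M borel X) u =
        exp (\<i> * of_real (b * u) - of_real (a * u\<^sup>2 / 2) +
          (CLINT x|\<nu>. exp (\<i> * of_real (u * x)) - 1 -
                      \<i> * of_real (u * x) * indicator {-1..1} x)))"

definition mgf :: "'a measure \<Rightarrow> ('a \<Rightarrow> real) \<Rightarrow> real \<Rightarrow> ereal" where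
  "mgf M X t = enn2ereal (\<integral>\<^sup>+ \<omega>. ennreal (exp (t * X \<omega>)) \<partial>M)"

definition cumulant :: "'a measure \<Rightarrow> ('a \<Rightarrow> real) \<Rightarrow> real \<Rightarrow> ereal" where
  "cumulant M X t =
     (if mgf M X t = \<infinity> then \<infinity> else ereal (ln (real_of_ereal (mgf M X t))))"

text \<open>In \<open>ereal\<close>, \<open>1 / 0 = \<infinity>\<close>, so every \<open>t \<ge> 0\<close> is tested when \<open>c = 0\<close>.\<close>

definition feasible_scale :: "'a measure \<Rightarrow> ('a \<Rightarrow> real) \<Rightarrow> real \<Rightarrow> bool" where
  "feasible_scale M X c \<longleftrightarrow> 0 \<le> c \<and>
     (\<forall>t. 0 \<le> t \<and> ereal t < 1 / ereal c \<longrightarrow>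
        cumulant M X t \<le> ereal (prob_space.variance M X * t\<^sup>2 / (2 * (1 - c * t))))"

definition c_plus :: "'a measure \<Rightarrow> ('a \<Rightarrow> real) \<Rightarrow> ereal" where
  "c_plus M X = Inf (ereal ` {c. feasible_scale M X c})"

definition c_minus :: "'a measure \<Rightarrow> ('a \<Rightarrow> real) \<Rightarrow> ereal" where
  "c_minus M X = c_plus M (\<lambda>\<omega>. - X \<omega>)"

definition tau_plus :: "'a measure \<Rightarrow> ('a \<Rightarrow> real) \<Rightarrow> ereal" where
  "tau_plus M X =
     (let S = {t::real. 0 < t \<and> cumulant M X t < \<infinity>}
      in if S = {} then 0 else Sup (ereal ` S))"

definition tau_minus :: "'a measure \<Rightarrow> ('a \<Rightarrow> real) \<Rightarrow> ereal" where
  "tau_minus M X = tau_plus M (\<lambda>\<omega>. - X \<omega>)"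

text \<open>The law \<open>(a \<delta>\<^sub>0 + x\<^sup>2 \<nu>(dx)) / V\<close> with \<open>V = a + \<integral> x\<^sup>2 d\<nu>\<close>.\<close>

definition canonical_law :: "real \<Rightarrow> real measure \<Rightarrow> real measure" where
  "canonical_law a \<nu> = measure_of UNIV (sets borel)
     (\<lambda>A. (ennreal a * indicator A 0 + (\<integral>\<^sup>+ x\<in>A. ennreal (x\<^sup>2) \<partial>\<nu>)) /
          (ennreal a + (\<integral>\<^sup>+ x. ennreal (x\<^sup>2) \<partial>\<nu>)))"

definition beta_1_2 :: "real measure" where
  "beta_1_2 = density lborel (\<lambda>b. ennreal (2 * (1 - b)) * indicator {0<..<1} b)"

text \<open>The law of the signed canonical remainder \<open>B * Y\<close>; independence of \<open>B\<close> and \<open>Y\<close> is the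
  product measure.\<close>

definition remainder_law :: "real \<Rightarrow> real measure \<Rightarrow> real measure" where
  "remainder_law a \<nu> = distr (beta_1_2 \<Otimes>\<^sub>M canonical_law a \<nu>) borel (\<lambda>(b, y). b * y)"

definition Psi_plus :: "real \<Rightarrow> real measure \<Rightarrow> real \<Rightarrow> ereal" where
  "Psi_plus a \<nu> t = (1 - 1 / mgf (remainder_law a \<nu>) (\<lambda>r. r) t) / ereal t"

definition Psi_minus :: "real \<Rightarrow> real measure \<Rightarrow> real \<Rightarrow> ereal" where
  "Psi_minus a \<nu> t = (1 - 1 / mgf (remainder_law a \<nu>) (\<lambda>r. r) (- t)) / ereal t"

end

theory Submission
  imports Defs
begin

text \<open>
  Let \<open>Y\<close> have the canonical law \<open>(a \<delta>\<^sub>0 + x\<^sup>2 \<nu>(dx)) / V\<close> and let \<open>U\<close> be uniform on \<open>[0, 1]\<close>.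
  Differentiating the Levy--Khintchine formula gives the zero-bias identity: \<open>U\<close> times the square-biased
  \<open>X\<close> has the law of \<open>X + U Y\<close>.  (Finiteness of \<open>\<integral> x\<^sup>2 d\<nu>\<close> comes from Fatou's lemma applied to
  \<open>\<integral> (1 - cos (u x)) d\<nu>\<close>.)  Tested against \<open>r \<mapsto> exp (s r)\<close> it becomes the Volterra equation
  \<open>M(t) = 1 + \<integral>\<^sub>0\<^sup>t M(s) V s E exp (s U Y) ds\<close> in \<open>[0, \<infinity>]\<close>, and tested against truncated exponentials the
  corresponding inequality for \<open>E exp (t min X n)\<close>.  Gronwall arguments in both directions yield
  \<open>K(t) = V t\<^sup>2 / 2 * E exp (t R)\<close>, including the case where one side is infinite.  Feasibility of \<open>c\<close> then
  reads \<open>E exp (t R) \<le> 1 / (1 - c t)\<close> whenever \<open>c t < 1\<close>, that is \<open>\<Psi>(t) \<le> c\<close> for every \<open>t > 0\<close>.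
\<close>

text \<open>The Levy--Khintchine formula is available only on the imaginary axis, and real
  exponential moments may be infinite, so real arguments cannot simply be inserted. An identity
  between laws avoids this: it can be tested against every nonnegative Borel function, with values
  in [0, \<infinity>] and no integrability to check. A Volterra equation in [0, \<infinity>] need
  not determine its solution, since the value infinity can be consistent with it. The upper estimate
  therefore has to go through bounded truncations, for which the equation survives as an inequality
  in the direction that is needed. Beta(1,2) is the weight of the second-order Taylor remainder: exp
  (t y) - 1 - t y = (t y)^2 / 2 * E exp (t B y). This merges the average over U and the integration
  over s in [0, t] with weight s into a single variable B. Infinite moments fit the criterion by
  themselves: then \<Psi>(t) = 1/t, and the bound by c says exactly that c t >= 1, so that t is not
  tested.\<close>

section \<open>A Gronwall inequality for Volterra equations\<close>

text \<open>Multiplying the step inequality along n points that are equally spaced in the values of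
  \<open>L\<close> gives a factor (1 + \<sigma> L(t)/n)^n, which tends to the exponential. Only
  continuity of \<open>L\<close> is needed, no derivative. The sign of \<sigma> is free: \<sigma> =
  1 serves lower bounds, \<sigma> = -1 upper bounds through the reciprocal.\<close>

lemma gronwall_multiplicative:
  fixes G L :: "real \<Rightarrow> real"
  assumes "0 \<le> t" and cont: "continuous_on {0..t} L" and L0: "L 0 = 0"
    and mono: "\<And>s s'. 0 \<le> s \<Longrightarrow> s \<le> s' \<Longrightarrow> s' \<le> t \<Longrightarrow> L s \<le> L s'"
    and nonneg: "\<And>s. 0 \<le> s \<Longrightarrow> s \<le> t \<Longrightarrow> 0 \<le> G s"
    and step: "\<And>s s'. 0 \<le> s \<Longrightarrow> s \<le> s' \<Longrightarrow> s' \<le> t \<Longrightarrow> G s * (1 + \<sigma> * (L s' - L s)) \<le> G s'"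
  shows "G 0 * exp (\<sigma> * L t) \<le> G t"
proof -
  have Lt: "0 \<le> L t" using mono[of 0 t] L0 \<open>0 \<le> t\<close> by simp
  have bound: "G 0 * (1 + \<sigma> * L t / real n) ^ n \<le> G t" if n: "0 < n" and pos: "0 \<le> 1 + \<sigma> * L t / real n" for n
  proof -
    \<comment> \<open>The i-th point is obtained from the intermediate value theorem as a preimage
      under \<open>L\<close> of i/n times \<open>L t\<close>.\<close>
    have "\<exists>s. 0 \<le> s \<and> s \<le> t \<and> L s = real i * (L t / n) \<and> G 0 * (1 + \<sigma> * L t / n) ^ i \<le> G s"
      if "i \<le> n" for i
      using that
    proof (induction i)
      case 0
      then show ?case using L0 \<open>0 \<le> t\<close> by (intro exI[of _ 0]) auto
    next
      case (Suc i)
      then obtain s where s: "0 \<le> s" "s \<le> t" "L s = real i * (L t / n)"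
        "G 0 * (1 + \<sigma> * L t / n) ^ i \<le> G s" by auto
      have c: "continuous_on {s..t} L" using cont s by (auto intro: continuous_on_subset)
      have "L s \<le> real (Suc i) * (L t / n)" unfolding s(3)
        by (rule mult_right_mono) (use Lt in auto)
      moreover have "real (Suc i) * (L t / n) \<le> real n * (L t / n)"
        using Suc.prems Lt n by (intro mult_right_mono) (auto simp del: of_nat_Suc)
      ultimately obtain s' where s': "s \<le> s'" "s' \<le> t" "L s' = real (Suc i) * (L t / n)"
        using IVT'[of L s "real (Suc i) * (L t / n)" t] c s(2) n by auto
      have "G 0 * (1 + \<sigma> * L t / n) ^ Suc i = (G 0 * (1 + \<sigma> * L t / n) ^ i) * (1 + \<sigma> * L t / n)"
        by (simp add: mult_ac)
      also have "\<dots> \<le> G s * (1 + \<sigma> * L t / n)" using s(4) pos by (intro mult_right_mono)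
      also have "G s * (1 + \<sigma> * L t / n) = G s * (1 + \<sigma> * (L s' - L s))"
        unfolding s'(3) s(3) by (simp add: algebra_simps add_divide_distrib)
      also have "\<dots> \<le> G s'" using step[of s s'] s s' by auto
      finally have "G 0 * (1 + \<sigma> * L t / n) ^ Suc i \<le> G s'" .
      moreover have "0 \<le> s'" using s(1) s'(1) by simp
      ultimately show ?case using s'(2,3) by (intro exI[of _ s'] conjI)
    qed
    from this[of n] obtain s where "0 \<le> s" "s \<le> t" "L s = L t" "G 0 * (1 + \<sigma> * L t / n) ^ n \<le> G s" using n by auto
    with step[of s t] show ?thesis by simp
  qed
  \<comment> \<open>For negative \<sigma> the factor is nonnegative only once n is large, hence the
    restriction to eventually all n.\<close>
  have ev: "\<forall>\<^sub>F n in sequentially. G 0 * (1 + \<sigma> * L t / real n) ^ n \<le> G t"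
  proof -
    have "((\<lambda>n. 1 + \<sigma> * L t / real n) \<longlongrightarrow> 1 + 0) sequentially"
      by (intro tendsto_intros lim_const_over_n)
    then have "\<forall>\<^sub>F n in sequentially. 1 + \<sigma> * L t / real n > 0"
      by (auto dest: order_tendstoD(1)[where a=0])
    then show ?thesis using eventually_gt_at_top[of 0]
      by eventually_elim (auto intro: bound)
  qed
  have "(\<lambda>n. G 0 * (1 + \<sigma> * L t / real n) ^ n) \<longlonglongrightarrow> G 0 * exp (\<sigma> * L t)"
    by (intro tendsto_intros tendsto_exp_limit_sequentially)
  from tendsto_upperbound[OF this ev] show ?thesis by simp
qed

lemma nn_integral_Icc_split:
  fixes f :: "real \<Rightarrow> ennreal"
  assumes [measurable]: "f \<in> borel_measurable borel" and "a \<le> b" "b \<le> c"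
  shows "(\<integral>\<^sup>+s\<in>{a..c}. f s \<partial>lborel) = (\<integral>\<^sup>+s\<in>{a..b}. f s \<partial>lborel) + (\<integral>\<^sup>+s\<in>{b<..c}. f s \<partial>lborel)"
  using assms by (subst nn_integral_add[symmetric])
    (auto intro!: nn_integral_cong simp: indicator_def split: if_splits)

text \<open>The kernel may be infinite on a null set. It is replaced by the real function
  \<open>g\<close>, whose indefinite integral is continuous.\<close>

lemma continuous_on_nn_integral_Icc:
  fixes k :: "real \<Rightarrow> ennreal"
  assumes [measurable]: "k \<in> borel_measurable borel"
    and fin: "(\<integral>\<^sup>+s\<in>{a..b}. k s \<partial>lborel) < \<infinity>"
  shows "continuous_on {a..b} (\<lambda>s. enn2real (\<integral>\<^sup>+r\<in>{a..s}. k r \<partial>lborel))"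
proof -
  define g where "g r = enn2real (k r) * indicator {a..b} r" for r
  have gm[measurable]: "g \<in> borel_measurable borel" unfolding g_def by measurable
  have "AE r in lborel. k r * indicator {a..b} r \<noteq> \<infinity>"
    using fin by (intro nn_integral_noteq_infinite) auto
  then have ae: "AE r in lborel. k r * indicator {a..b} r = ennreal (g r)"
    by eventually_elim (auto simp: g_def indicator_def less_top)
  have eq: "(\<integral>\<^sup>+r\<in>{a..s}. k r \<partial>lborel) = (\<integral>\<^sup>+r. ennreal (g r * indicator {a..s} r) \<partial>lborel)" if "s \<le> b" for s
  proof (intro nn_integral_cong_AE eventually_mono[OF ae])
    fix r assume "k r * indicator {a..b} r = ennreal (g r)"
    then show "k r * indicator {a..s} r = ennreal (g r * indicator {a..s} r)"
      using that by (cases "r \<in> {a..s}") auto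
  qed
  have int: "integrable lborel g"
  proof (rule integrableI_nonneg)
    have "(\<integral>\<^sup>+ x. ennreal (g x) \<partial>lborel) = (\<integral>\<^sup>+s\<in>{a..b}. k s \<partial>lborel)"
      using ae by (intro nn_integral_cong_AE) (auto elim: eventually_mono)
    with fin show "(\<integral>\<^sup>+ x. ennreal (g x) \<partial>lborel) < \<infinity>" by simp
  qed (auto simp: g_def)
  have HK: "enn2real (\<integral>\<^sup>+r\<in>{a..s}. k r \<partial>lborel) = integral {a..s} g" if "s \<in> {a..b}" for s
  proof -
    have i: "integrable lborel (\<lambda>r. g r * indicator {a..s} r)"
      using integrable_mult_indicator[OF _ int, of "{a..s}"] by (simp add: mult_ac)
    have "integral {a..s} g = integral UNIV (\<lambda>r. if r \<in> {a..s} then g r else 0)"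
      by (rule integral_restrict_UNIV[symmetric])
    also have "\<dots> = integral UNIV (\<lambda>r. g r * indicator {a..s} r)"
      by (intro integral_cong) (auto simp: indicator_def)
    also have "\<dots> = (\<integral>r. g r * indicator {a..s} r \<partial>lborel)"
      using integral_lborel[OF i] .
    also have "\<dots> = enn2real (\<integral>\<^sup>+r. ennreal (g r * indicator {a..s} r) \<partial>lborel)"
      by (intro integral_eq_nn_integral) (auto simp: g_def)
    also have "\<dots> = enn2real (\<integral>\<^sup>+r\<in>{a..s}. k r \<partial>lborel)" using eq that by simp
    finally show ?thesis by simp
  qed
  have "g integrable_on {a..b}"
    using integrable_on_lborel[OF int] by (rule integrable_on_subinterval) auto
  then have "continuous_on {a..b} (\<lambda>s. integral {a..s} g)"
    by (rule indefinite_integral_continuous_1)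
  then show ?thesis by (rule continuous_on_eq) (use HK in auto)
qed

text \<open>Since F >= 1, the integral of \<open>k\<close> is at most F(t), hence finite. Since F is
  nondecreasing, its increment over (s, s'] is at least F(s) times the integral of \<open>k\<close>
  there, which is the Gronwall step with \<sigma> = 1.\<close>

lemma volterra_lower:
  fixes k F :: "real \<Rightarrow> ennreal"
  assumes [measurable]: "k \<in> borel_measurable borel" "F \<in> borel_measurable borel" and "0 \<le> t"
    and eq: "\<And>s. 0 \<le> s \<Longrightarrow> s \<le> t \<Longrightarrow> F s = 1 + (\<integral>\<^sup>+r\<in>{0..s}. F r * k r \<partial>lborel)"
    and fin: "F t < \<infinity>"
  shows "(\<integral>\<^sup>+s\<in>{0..t}. k s \<partial>lborel) < \<infinity>"
    and "ennreal (exp (enn2real (\<integral>\<^sup>+s\<in>{0..t}. k s \<partial>lborel))) \<le> F t"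
proof -
  let ?L = "\<lambda>s. (\<integral>\<^sup>+r\<in>{0..s}. k r \<partial>lborel)"
  have F1: "1 \<le> F s" if "0 \<le> s" "s \<le> t" for s using eq[OF that] by simp
  have "?L t \<le> (\<integral>\<^sup>+r\<in>{0..t}. F r * k r \<partial>lborel)"
    using F1 mult_right_mono[of 1 _ "k _"] by (intro nn_integral_mono) (auto simp: indicator_def)
  also have "\<dots> \<le> F t" using eq[of t] \<open>0 \<le> t\<close> by simp
  finally show L: "?L t < \<infinity>" using fin by (rule le_less_trans)
  have Lmono: "?L s \<le> ?L s'" if "s \<le> s'" for s s'
    using that by (intro nn_integral_mono) (auto simp: indicator_def)
  have Lfin: "?L s < \<infinity>" if "s \<le> t" for s using Lmono[OF that] L by (rule le_less_trans)
  have Fmono: "F s \<le> F s'" if "0 \<le> s" "s \<le> s'" "s' \<le> t" for s s'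
    using that by (subst (1 2) eq) (auto intro!: add_left_mono nn_integral_mono simp: indicator_def)
  have Ffin: "F s < \<infinity>" if "0 \<le> s" "s \<le> t" for s
    using Fmono[of s t] that fin by (auto intro: le_less_trans)
  have "enn2real (F 0) * exp (1 * enn2real (?L t)) \<le> enn2real (F t)"
  proof (rule gronwall_multiplicative[where L="\<lambda>s. enn2real (?L s)" and G="\<lambda>s. enn2real (F s)"])
    show "enn2real (?L 0) = 0"
      by (simp add: nn_integral_indicator_singleton)
    show "continuous_on {0..t} (\<lambda>s. enn2real (?L s))"
      using L by (intro continuous_on_nn_integral_Icc) auto
    fix s s' :: real assume s: "0 \<le> s" "s \<le> s'" "s' \<le> t"
    then show "enn2real (?L s) \<le> enn2real (?L s')"
      using Lmono Lfin by (intro enn2real_mono) auto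
    let ?D = "(\<integral>\<^sup>+r\<in>{s<..s'}. k r \<partial>lborel)"
    have LD: "?L s' = ?L s + ?D" using s by (intro nn_integral_Icc_split) auto
    have D: "?D < \<infinity>" using LD Lfin[of s'] s(3) by (cases "?D = \<infinity>") (auto simp: less_top)
    have D': "enn2real (?L s') - enn2real (?L s) = enn2real ?D"
      unfolding LD using Lfin[of s] s D by (subst enn2real_plus) auto
    \<comment> \<open>On (s, s'] the function is bounded below by its value at the left
      endpoint.\<close>
    have "F s + F s * ?D \<le> F s + (\<integral>\<^sup>+r\<in>{s<..s'}. F r * k r \<partial>lborel)"
      using Fmono s
      by (subst nn_integral_cmult[symmetric])
         (auto intro!: add_left_mono nn_integral_mono mult_right_mono simp: indicator_def)
    also have "\<dots> = F s'"
      using s nn_integral_Icc_split[of "\<lambda>r. F r * k r" 0 s s']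
      by (subst (1 2) eq) (auto simp: add.assoc)
    finally have "enn2real (F s + F s * ?D) \<le> enn2real (F s')"
      using Ffin[of s'] s by (intro enn2real_mono) auto
    then show "enn2real (F s) * (1 + 1 * (enn2real (?L s') - enn2real (?L s))) \<le> enn2real (F s')"
      unfolding D' using Ffin[of s] s D
      by (subst (asm) enn2real_plus) (auto simp: ennreal_mult_less_top enn2real_mult distrib_left)
  qed (use \<open>0 \<le> t\<close> in auto)
  moreover have "F 0 = 1" using eq[of 0] \<open>0 \<le> t\<close> by (simp add: nn_integral_indicator_singleton)
  ultimately have "ennreal (exp (enn2real (?L t))) \<le> ennreal (enn2real (F t))" by (simp add: ennreal_leI)
  then show "ennreal (exp (enn2real (?L t))) \<le> F t" using fin by (subst (asm) ennreal_enn2real) (auto simp: less_top)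
qed

text \<open>The right-hand side F of the inequality is nondecreasing and dominates \<open>A\<close>,
  so F(s') (1 - D) <= F(s), where D is the integral of \<open>k\<close> over (s, s']. Thus 1/F
  satisfies the Gronwall step with \<sigma> = -1. The constant \<open>C\<close> is used only for
  finiteness of F, so it may depend on the truncation level.\<close>

lemma volterra_upper:
  fixes k A :: "real \<Rightarrow> ennreal"
  assumes [measurable]: "k \<in> borel_measurable borel" "A \<in> borel_measurable borel" and "0 \<le> t"
    and le: "\<And>s. 0 \<le> s \<Longrightarrow> s \<le> t \<Longrightarrow> A s \<le> 1 + (\<integral>\<^sup>+r\<in>{0..s}. A r * k r \<partial>lborel)"
    and bound: "\<And>s. 0 \<le> s \<Longrightarrow> s \<le> t \<Longrightarrow> A s \<le> ennreal C"
    and L: "(\<integral>\<^sup>+s\<in>{0..t}. k s \<partial>lborel) < \<infinity>"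
  shows "A t \<le> ennreal (exp (enn2real (\<integral>\<^sup>+s\<in>{0..t}. k s \<partial>lborel)))"
proof -
  let ?L = "\<lambda>s. (\<integral>\<^sup>+r\<in>{0..s}. k r \<partial>lborel)"
  define F where "F s = 1 + (\<integral>\<^sup>+r\<in>{0..s}. A r * k r \<partial>lborel)" for s
  have Lmono: "?L s \<le> ?L s'" if "s \<le> s'" for s s'
    using that by (intro nn_integral_mono) (auto simp: indicator_def)
  have Lfin: "?L s < \<infinity>" if "s \<le> t" for s using Lmono[OF that] L by (rule le_less_trans)
  have Fmono: "F s \<le> F s'" if "s \<le> s'" for s s'
    using that unfolding F_def by (auto intro!: add_left_mono nn_integral_mono simp: indicator_def)
  have "(\<integral>\<^sup>+r\<in>{0..t}. A r * k r \<partial>lborel) \<le> (\<integral>\<^sup>+r\<in>{0..t}. ennreal C * k r \<partial>lborel)"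
    using bound by (intro nn_integral_mono) (auto intro!: mult_right_mono simp: indicator_def)
  also have "\<dots> = ennreal C * ?L t" by (simp add: nn_integral_cmult mult.assoc)
  also have "\<dots> < \<infinity>" using L by (simp add: ennreal_mult_less_top)
  finally have "F t < \<infinity>" unfolding F_def by simp
  then have Ffin: "F s < \<infinity>" if "s \<le> t" for s
    using Fmono[OF that] by (auto intro: le_less_trans)
  have F1: "1 \<le> F s" for s unfolding F_def by simp
  have Fpos: "1 \<le> enn2real (F s)" if "s \<le> t" for s
    using enn2real_mono[OF F1[of s]] Ffin[OF that] by simp
  have "inverse (enn2real (F 0)) * exp (-1 * enn2real (?L t)) \<le> inverse (enn2real (F t))"
  proof (rule gronwall_multiplicative[where L="\<lambda>s. enn2real (?L s)" and G="\<lambda>s. inverse (enn2real (F s))"])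
    show "enn2real (?L 0) = 0"
      by (simp add: nn_integral_indicator_singleton)
    show "continuous_on {0..t} (\<lambda>s. enn2real (?L s))"
      using L by (intro continuous_on_nn_integral_Icc) auto
    fix s s' :: real assume s: "0 \<le> s" "s \<le> s'" "s' \<le> t"
    then show "enn2real (?L s) \<le> enn2real (?L s')"
      using Lmono Lfin by (intro enn2real_mono) auto
    let ?D = "(\<integral>\<^sup>+r\<in>{s<..s'}. k r \<partial>lborel)"
    have LD: "?L s' = ?L s + ?D" using s by (intro nn_integral_Icc_split) auto
    have D: "?D < \<infinity>" using LD Lfin[of s'] s(3) by (cases "?D = \<infinity>") (auto simp: less_top)
    have D': "enn2real (?L s') - enn2real (?L s) = enn2real ?D"
      unfolding LD using Lfin[of s] s D by (subst enn2real_plus) auto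
    have AF: "A r \<le> F s'" if "s < r" "r \<le> s'" for r
      using le[of r] Fmono[of r s'] that s unfolding F_def by (auto intro: order_trans)
    have "F s' = F s + (\<integral>\<^sup>+r\<in>{s<..s'}. A r * k r \<partial>lborel)"
      unfolding F_def using s nn_integral_Icc_split[of "\<lambda>r. A r * k r" 0 s s'] by (auto simp: add.assoc)
    \<comment> \<open>Here the value at the right endpoint is the bound, in contrast to the lower
      estimate.\<close>
    also have "\<dots> \<le> F s + F s' * ?D"
      using AF
      by (subst nn_integral_cmult[symmetric])
         (auto intro!: add_left_mono nn_integral_mono mult_right_mono simp: indicator_def)
    finally have "enn2real (F s') \<le> enn2real (F s + F s' * ?D)"
      using Ffin[of s] Ffin[of s'] s D by (intro enn2real_mono) (auto simp: ennreal_mult_less_top)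
    then have "enn2real (F s') * (1 - enn2real ?D) \<le> enn2real (F s)"
      using Ffin[of s] Ffin[of s'] s D
      by (subst (asm) enn2real_plus) (auto simp: ennreal_mult_less_top enn2real_mult algebra_simps)
    then show "inverse (enn2real (F s)) * (1 + - 1 * (enn2real (?L s') - enn2real (?L s))) \<le> inverse (enn2real (F s'))"
      unfolding D' using Fpos[of s] Fpos[of s'] s by (simp add: field_simps)
  next
    fix s assume "0 \<le> s" "s \<le> t" then show "0 \<le> inverse (enn2real (F s))" using Fpos[of s] by simp
  qed (use \<open>0 \<le> t\<close> in auto)
  moreover have "F 0 = 1" unfolding F_def by (simp add: nn_integral_indicator_singleton)
  ultimately have "enn2real (F t) \<le> exp (enn2real (?L t))"
    using Fpos[of t] by (simp add: exp_minus field_simps)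
  then have "ennreal (enn2real (F t)) \<le> ennreal (exp (enn2real (?L t)))" by (rule ennreal_leI)
  then have "F t \<le> ennreal (exp (enn2real (?L t)))" using \<open>F t < \<infinity>\<close> by (subst (asm) ennreal_enn2real) (auto simp: less_top)
  then show ?thesis using le[of t] \<open>0 \<le> t\<close> unfolding F_def by (auto intro: order_trans)
qed

section \<open>Exponential integrals\<close>

text \<open>This removes a centered linear term from under an integral that may be infinite: if the
  right side is finite, then \<open>h\<close> is integrable and ordinary linearity applies.\<close>

lemma nn_integral_le_diff:
  fixes h g :: "'a \<Rightarrow> real"
  assumes "integrable M g" "(\<integral>x. g x \<partial>M) \<le> 0" and [measurable]: "h \<in> borel_measurable M"
    and "\<And>x. 0 \<le> h x" "\<And>x. 0 \<le> h x - g x"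
  shows "(\<integral>\<^sup>+x. ennreal (h x) \<partial>M) \<le> (\<integral>\<^sup>+x. ennreal (h x - g x) \<partial>M)"
proof (cases "(\<integral>\<^sup>+x. ennreal (h x - g x) \<partial>M) = \<infinity>")
  case False
  have gm[measurable]: "g \<in> borel_measurable M" using assms(1) by auto
  have "integrable M (\<lambda>x. h x - g x)"
    using False assms(5) by (intro integrableI_nonneg) (auto simp: less_top)
  from Bochner_Integration.integrable_add[OF this assms(1)]
  have h: "integrable M h" by simp
  have "(\<integral>\<^sup>+x. ennreal (h x) \<partial>M) = ennreal (\<integral>x. h x \<partial>M)"
    using h assms(4) by (intro nn_integral_eq_integral) auto
  also have "\<dots> \<le> ennreal (\<integral>x. h x - g x \<partial>M)"
    using h assms(1,2) by (intro ennreal_leI) simp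
  also have "\<dots> = (\<integral>\<^sup>+x. ennreal (h x - g x) \<partial>M)"
    using h assms(1,5) by (intro nn_integral_eq_integral[symmetric]) auto
  finally show ?thesis .
qed simp

lemma exp_minus_one_mult_nonneg: "0 \<le> s \<Longrightarrow> 0 \<le> m * (exp (s * m) - 1)" for s m :: real
  by (cases "0 \<le> m") (auto simp: mult_nonneg_nonneg mult_nonpos_nonpos mult_nonneg_nonpos)

text \<open>The right-hand side is the s-derivative of exp (s m) - 1 - s m. Keeping the factor s m^2
  on the left, instead of dividing by it, makes the formula valid also for s m = 0.\<close>

lemma nn_integral_exp_scaled:
  assumes "0 \<le> s"
  shows "ennreal (s * m\<^sup>2) * (\<integral>\<^sup>+u\<in>{0..1}. ennreal (exp (s * (u * m))) \<partial>lborel) = ennreal (m * (exp (s * m) - 1))"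
proof (cases "s * m = 0")
  case False
  have "(\<integral>\<^sup>+u. ennreal (exp (s * (u * m))) * indicator {0..1} u \<partial>lborel) =
     ennreal (exp (s * (1 * m)) / (s * m) - exp (s * (0 * m)) / (s * m))"
    by (intro nn_integral_FTC_Icc) (use False in \<open>auto intro!: derivative_eq_intros\<close>)
  then have "ennreal (s * m\<^sup>2) * (\<integral>\<^sup>+u\<in>{0..1}. ennreal (exp (s * (u * m))) \<partial>lborel) =
    ennreal (s * m\<^sup>2 * (exp (s * (1 * m)) / (s * m) - exp (s * (0 * m)) / (s * m)))"
    using assms by (simp add: ennreal_mult')
  also have "s * m\<^sup>2 * (exp (s * (1 * m)) / (s * m) - exp (s * (0 * m)) / (s * m)) = m * (exp (s * m) - 1)"
    using False by (simp add: field_simps power2_eq_square)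
  finally show ?thesis .
qed auto

lemma nn_integral_exp_excess:
  assumes "0 \<le> t"
  shows "(\<integral>\<^sup>+s\<in>{0..t}. ennreal (m * (exp (s * m) - 1)) \<partial>lborel) = ennreal (exp (t * m) - 1 - t * m)"
proof -
  have "(\<integral>\<^sup>+s. ennreal (m * (exp (s * m) - 1)) * indicator {0..t} s \<partial>lborel) =
     ennreal ((exp (t * m) - t * m) - (exp (0 * m) - 0 * m))"
    by (intro nn_integral_FTC_Icc)
      (use assms exp_minus_one_mult_nonneg in \<open>auto intro!: derivative_eq_intros simp: algebra_simps\<close>)
  then show ?thesis by (simp add: algebra_simps)
qed

text \<open>This is the pointwise bound for the square-biased side of the identity with test
  function r \<mapsto> exp (s r) on r <= n. For x <= n there is equality. For x > n only u <= n/x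
  contributes, and rescaling u leaves a surplus factor x/n >= 1.\<close>

lemma nn_integral_truncated_exp_ge:
  assumes s: "0 \<le> s" and n: "0 \<le> n"
  shows "ennreal (min x n * (exp (s * min x n) - 1)) \<le>
     ennreal (s * x\<^sup>2) * (\<integral>\<^sup>+u\<in>{0..1}. ennreal (exp (s * (u * x))) * indicator {..n} (u * x) \<partial>lborel)"
proof (cases "x \<le> n")
  case True
  have "u * x \<le> n" if "0 \<le> u" "u \<le> 1" for u
  proof (cases "0 \<le> x")
    case True
    then show ?thesis using \<open>x \<le> n\<close> that mult_left_le_one_le[of x u] by simp
  next
    case False
    then show ?thesis using n that mult_nonneg_nonpos[of u x] by simp
  qed
  then have "(\<integral>\<^sup>+u\<in>{0..1}. ennreal (exp (s * (u * x))) * indicator {..n} (u * x) \<partial>lborel) =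
     (\<integral>\<^sup>+u\<in>{0..1}. ennreal (exp (s * (u * x))) \<partial>lborel)"
    by (intro nn_integral_cong) (auto simp: indicator_def)
  then show ?thesis using True nn_integral_exp_scaled[OF s] by (simp add: min_def)
next
  case False
  then have x: "n < x" "0 < x" using n by auto
  show ?thesis
  proof (cases "n = 0")
    case True then show ?thesis using x by simp
  next
    case False
    then have n: "0 < n" using assms by simp
    \<comment> \<open>\<open>c\<close> is the largest u for which u x stays below the cut; the
      substitution u = c v turns u x into v n.\<close>
    define c where "c = n / x"
    have c: "0 < c" "c \<le> 1" "c * x = n" using x n by (auto simp: c_def)
    have "(\<integral>\<^sup>+u. ennreal (exp (s * (u * x))) * indicator {..n} (u * x) * indicator {0..1} u \<partial>lborel)
      = ennreal c * (\<integral>\<^sup>+v. ennreal (exp (s * ((0 + c * v) * x))) * indicator {..n} ((0 + c * v) * x) * indicator {0..1} (0 + c * v) \<partial>lborel)"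
      using c by (subst nn_integral_real_affine[where c=c and t=0]) auto
    moreover have "\<dots> \<ge> ennreal c * (\<integral>\<^sup>+v\<in>{0..1}. ennreal (exp (s * (v * n))) \<partial>lborel)"
    proof (intro mult_left_mono nn_integral_mono)
      fix v
      have e: "(0 + c * v) * x = v * n" using c(3) by (simp add: mult_ac)
      have "v * n \<le> n" "0 \<le> c * v" "c * v \<le> 1" if "0 \<le> v" "v \<le> 1"
        using that n c(1,2) mult_le_one[of c v] by (auto simp: mult_left_le_one_le)
      then show "ennreal (exp (s * (v * n))) * indicator {0..1} v \<le>
         ennreal (exp (s * ((0 + c * v) * x))) * indicator {..n} ((0 + c * v) * x) * indicator {0..1} (0 + c * v)"
        unfolding e by (auto simp: indicator_def)
    qed simp
    ultimately have "ennreal c * (\<integral>\<^sup>+v\<in>{0..1}. ennreal (exp (s * (v * n))) \<partial>lborel) \<le>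
        (\<integral>\<^sup>+u\<in>{0..1}. ennreal (exp (s * (u * x))) * indicator {..n} (u * x) \<partial>lborel)" by simp
    then have "ennreal (s * x\<^sup>2) * (ennreal c * (\<integral>\<^sup>+v\<in>{0..1}. ennreal (exp (s * (v * n))) \<partial>lborel)) \<le>
      ennreal (s * x\<^sup>2) * (\<integral>\<^sup>+u\<in>{0..1}. ennreal (exp (s * (u * x))) * indicator {..n} (u * x) \<partial>lborel)"
      by (rule mult_left_mono) simp
    moreover have "ennreal (s * n\<^sup>2) \<le> ennreal (s * x\<^sup>2 * c)"
    proof -
      have "n\<^sup>2 = n * (c * x)" using c by (simp add: power2_eq_square)
      also have "\<dots> \<le> x * (c * x)" using x c n by (intro mult_right_mono) auto
      finally have "n\<^sup>2 \<le> x\<^sup>2 * c" by (simp add: power2_eq_square mult_ac)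
      then show ?thesis using s by (intro ennreal_leI) (simp add: mult_left_mono mult.assoc)
    qed
    then have "ennreal (s * n\<^sup>2) \<le> ennreal (s * x\<^sup>2) * ennreal c"
      using s c by (simp add: ennreal_mult)
    then have "ennreal (s * n\<^sup>2) * (\<integral>\<^sup>+v\<in>{0..1}. ennreal (exp (s * (v * n))) \<partial>lborel) \<le>
      ennreal (s * x\<^sup>2) * ennreal c * (\<integral>\<^sup>+v\<in>{0..1}. ennreal (exp (s * (v * n))) \<partial>lborel)"
      by (rule mult_right_mono) simp
    moreover have "min x n = n" using x by simp
    ultimately show ?thesis
      using nn_integral_exp_scaled[OF s, of n] by (simp add: mult.assoc)
  qed
qed

text \<open>This is the companion bound for the side X + U Y. The segment from x to x + y meets the
  half-line r <= n either not at all or from its entry point on; restarting it at n can only enlarge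
  the integral.\<close>

lemma nn_integral_truncated_exp_shift_le:
  assumes s: "0 \<le> s"
  shows "(\<integral>\<^sup>+u\<in>{0..1}. ennreal (exp (s * (x + u * y))) * indicator {..n} (x + u * y) \<partial>lborel)
     \<le> ennreal (exp (s * min x n)) * (\<integral>\<^sup>+u\<in>{0..1}. ennreal (exp (s * (u * y))) \<partial>lborel)"
    (is "_ \<le> ?E * ?I")
proof (cases "x \<le> n")
  case True
  then show ?thesis
    by (subst nn_integral_cmult[symmetric])
      (auto intro!: nn_integral_mono simp: indicator_def ennreal_mult'[symmetric] exp_add[symmetric] algebra_simps)
next
  case x: False
  show ?thesis
  proof (cases "0 \<le> y")
    case True
    have "x + u * y > n" if "0 \<le> u" for u using x mult_nonneg_nonneg[OF that True] by linarith
    then have "(\<integral>\<^sup>+u\<in>{0..1}. ennreal (exp (s * (x + u * y))) * indicator {..n} (x + u * y) \<partial>lborel) = (\<integral>\<^sup>+u. 0 \<partial>(lborel::real measure))"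
      by (intro nn_integral_cong) (auto simp: indicator_def not_le[symmetric] simp del: not_le)
    then show ?thesis by simp
  next
    case False
    \<comment> \<open>\<open>d\<close> is the time at which the decreasing segment x + u y reaches
      n; from there on it runs as n + v y with v = u - d.\<close>
    define d where "d = (n - x) / y"
    have d: "0 < d" "x + d * y = n" using x False by (auto simp: d_def divide_neg_neg)
    have "(\<integral>\<^sup>+u\<in>{0..1}. ennreal (exp (s * (x + u * y))) * indicator {..n} (x + u * y) \<partial>lborel) =
      (\<integral>\<^sup>+v. ennreal (exp (s * (x + (d + 1 * v) * y))) * indicator {..n} (x + (d + 1 * v) * y) * indicator {0..1} (d + 1 * v) \<partial>lborel)"
      by (subst nn_integral_real_affine[where c=1 and t=d]) auto
    also have "\<dots> \<le> (\<integral>\<^sup>+v. ?E * (ennreal (exp (s * (v * y))) * indicator {0..1} v) \<partial>lborel)"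
    proof (rule nn_integral_mono)
      fix v
      have e: "x + (d + 1 * v) * y = n + v * y" using d by (simp add: algebra_simps)
      have "0 \<le> v" if "n + v * y \<le> n" using that False by (simp add: mult_le_0_iff)
      then show "ennreal (exp (s * (x + (d + 1 * v) * y))) * indicator {..n} (x + (d + 1 * v) * y) * indicator {0..1} (d + 1 * v)
        \<le> ?E * (ennreal (exp (s * (v * y))) * indicator {0..1} v)"
        unfolding e using d x by (auto simp: indicator_def ennreal_mult'[symmetric] exp_add[symmetric] algebra_simps min_def)
    qed
    also have "\<dots> = ?E * ?I" by (rule nn_integral_cmult) simp
    finally show ?thesis .
  qed
qed

section \<open>Moment generating functions under the zero-bias identity\<close>

lemma nn_integral_beta_1_2:
  assumes [measurable]: "f \<in> borel_measurable borel" and "\<And>b. 0 \<le> f b"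
  shows "(\<integral>\<^sup>+b. ennreal (f b) \<partial>beta_1_2) = (\<integral>\<^sup>+b\<in>{0..1}. ennreal (2 * (1 - b) * f b) \<partial>lborel)"
  unfolding beta_1_2_def
proof (subst nn_integral_density)
  have "AE b in (lborel::real measure). b \<noteq> 0" by (rule AE_lborel_singleton)
  moreover have "AE b in (lborel::real measure). b \<noteq> 1" by (rule AE_lborel_singleton)
  ultimately show "(\<integral>\<^sup>+x. ennreal (2 * (1 - x)) * indicator {0<..<1} x * ennreal (f x) \<partial>lborel) =
    (\<integral>\<^sup>+b\<in>{0..1}. ennreal (2 * (1 - b) * f b) \<partial>lborel)"
    by (intro nn_integral_cong_AE, eventually_elim) (use assms(2) in \<open>auto simp: indicator_def ennreal_mult'\<close>)
qed auto

lemma sets_beta_1_2[measurable_cong]: "sets beta_1_2 = sets borel"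
  by (simp add: beta_1_2_def)

lemma prob_space_beta_1_2: "prob_space beta_1_2"
proof
  have "(\<integral>\<^sup>+b. ennreal (2 * (1 - b)) * indicator {0..1} b \<partial>lborel) = ennreal ((2 * 1 - 1\<^sup>2) - (2 * 0 - 0\<^sup>2))"
    by (intro nn_integral_FTC_Icc) (auto intro!: derivative_eq_intros)
  then show "emeasure beta_1_2 (space beta_1_2) = 1"
    using nn_integral_beta_1_2[of "\<lambda>_. 1"] by simp
qed

lemma uminus_measurable:
  assumes "sets Q = sets (borel :: real measure)"
  shows "uminus \<in> borel_measurable Q"
  using assms
  by (simp add: borel_measurable_continuous_onI continuous_on_minus continuous_on_id cong: measurable_cong_sets)

locale zero_bias =
  fixes N \<kappa> :: "real measure" and V :: real
  assumes prob_N: "prob_space N" and prob_\<kappa>: "prob_space \<kappa>"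
    and sets_N[measurable_cong]: "sets N = sets borel" and sets_\<kappa>[measurable_cong]: "sets \<kappa> = sets borel"
    and V_pos: "0 < V" and integrable_N: "integrable N (\<lambda>x. x)" and mean_N: "(\<integral>x. x \<partial>N) = 0"
    and biased: "f \<in> borel_measurable borel \<Longrightarrow>
     (\<integral>\<^sup>+x. ennreal (x\<^sup>2) * (\<integral>\<^sup>+u\<in>{0..1}. f (u * x) \<partial>lborel) \<partial>N) =
     ennreal V * (\<integral>\<^sup>+x. \<integral>\<^sup>+y. (\<integral>\<^sup>+u\<in>{0..1}. f (x + u * y) \<partial>lborel) \<partial>\<kappa> \<partial>N)"
begin

sublocale N: prob_space N by (rule prob_N)
sublocale \<kappa>: prob_space \<kappa> by (rule prob_\<kappa>)
sublocale lborel_N: pair_sigma_finite lborel N ..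
sublocale lborel_\<kappa>: pair_sigma_finite lborel \<kappa> ..

definition avg_exp :: "real \<Rightarrow> ennreal" where
  "avg_exp s = (\<integral>\<^sup>+y. (\<integral>\<^sup>+u\<in>{0..1}. ennreal (exp (s * (u * y))) \<partial>lborel) \<partial>\<kappa>)"

text \<open>The candidate for the derivative of the cumulant function. No differentiability is
  claimed, and infinite values are allowed.\<close>

definition rate :: "real \<Rightarrow> ennreal" where
  "rate s = ennreal (V * s) * avg_exp s"

definition cgf :: "real \<Rightarrow> ennreal" where
  "cgf t = (\<integral>\<^sup>+s\<in>{0..t}. rate s \<partial>lborel)"

lemma rate_measurable[measurable]: "rate \<in> borel_measurable borel"
  unfolding rate_def avg_exp_def by measurable

text \<open>Testing with r \<mapsto> exp (s r) factorizes on the side of X + U Y. On the other side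
  the integral over u yields x (exp (s x) - 1), which is nonnegative, unlike the formal derivative x
  exp (s x).\<close>

lemma exp_times_rate:
  assumes s: "0 \<le> s"
  shows "(\<integral>\<^sup>+x. ennreal (exp (s * x)) \<partial>N) * rate s = (\<integral>\<^sup>+x. ennreal (x * (exp (s * x) - 1)) \<partial>N)"
proof -
  have "(\<integral>\<^sup>+x. ennreal (x * (exp (s * x) - 1)) \<partial>N) =
      (\<integral>\<^sup>+x. ennreal s * (ennreal (x\<^sup>2) * (\<integral>\<^sup>+u\<in>{0..1}. ennreal (exp (s * (u * x))) \<partial>lborel)) \<partial>N)"
    using s by (simp add: nn_integral_exp_scaled[symmetric] ennreal_mult mult.assoc)
  also have "\<dots> = ennreal s * (ennreal V * (\<integral>\<^sup>+x. \<integral>\<^sup>+y. (\<integral>\<^sup>+u\<in>{0..1}. ennreal (exp (s * (x + u * y))) \<partial>lborel) \<partial>\<kappa> \<partial>N))"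
    by (subst nn_integral_cmult) (measurable, subst biased[of "\<lambda>r. ennreal (exp (s * r))"], auto)
  also have "(\<integral>\<^sup>+x. \<integral>\<^sup>+y. (\<integral>\<^sup>+u\<in>{0..1}. ennreal (exp (s * (x + u * y))) \<partial>lborel) \<partial>\<kappa> \<partial>N) =
      (\<integral>\<^sup>+x. \<integral>\<^sup>+y. (\<integral>\<^sup>+u. ennreal (exp (s * x)) * (ennreal (exp (s * (u * y))) * indicator {0..1} u) \<partial>lborel) \<partial>\<kappa> \<partial>N)"
    by (simp add: distrib_left exp_add ennreal_mult mult.assoc)
  also have "\<dots> = (\<integral>\<^sup>+x. ennreal (exp (s * x)) * avg_exp s \<partial>N)"
    unfolding avg_exp_def by (simp add: nn_integral_cmult)
  also have "\<dots> = (\<integral>\<^sup>+x. ennreal (exp (s * x)) \<partial>N) * avg_exp s"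
    by (simp add: nn_integral_multc)
  finally show ?thesis unfolding rate_def using s V_pos by (simp add: ennreal_mult mult_ac)
qed

text \<open>The test function is exp (s r) cut to zero above n. Both pointwise comparisons lose in
  the same direction, which leaves the inequality for the variable min x n.\<close>

lemma truncated_exp_times_rate:
  assumes s: "0 \<le> s" and n: "0 \<le> n"
  shows "(\<integral>\<^sup>+x. ennreal (min x n * (exp (s * min x n) - 1)) \<partial>N) \<le> (\<integral>\<^sup>+x. ennreal (exp (s * min x n)) \<partial>N) * rate s"
proof -
  have "(\<integral>\<^sup>+x. ennreal (min x n * (exp (s * min x n) - 1)) \<partial>N) \<le>
      (\<integral>\<^sup>+x. ennreal s * (ennreal (x\<^sup>2) * (\<integral>\<^sup>+u\<in>{0..1}. ennreal (exp (s * (u * x))) * indicator {..n} (u * x) \<partial>lborel)) \<partial>N)"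
    using nn_integral_truncated_exp_ge[OF s n] s by (intro nn_integral_mono) (simp add: ennreal_mult mult.assoc)
  also have "\<dots> = ennreal s * (ennreal V * (\<integral>\<^sup>+x. \<integral>\<^sup>+y. (\<integral>\<^sup>+u\<in>{0..1}. ennreal (exp (s * (x + u * y))) * indicator {..n} (x + u * y) \<partial>lborel) \<partial>\<kappa> \<partial>N))"
    by (subst nn_integral_cmult) (measurable, subst biased[of "\<lambda>r. ennreal (exp (s * r)) * indicator {..n} r"], auto)
  also have "\<dots> \<le> ennreal s * (ennreal V * (\<integral>\<^sup>+x. \<integral>\<^sup>+y. ennreal (exp (s * min x n)) * (\<integral>\<^sup>+u\<in>{0..1}. ennreal (exp (s * (u * y))) \<partial>lborel) \<partial>\<kappa> \<partial>N))"
    by (intro mult_left_mono nn_integral_mono nn_integral_truncated_exp_shift_le s) auto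
  also have "(\<integral>\<^sup>+x. \<integral>\<^sup>+y. ennreal (exp (s * min x n)) * (\<integral>\<^sup>+u\<in>{0..1}. ennreal (exp (s * (u * y))) \<partial>lborel) \<partial>\<kappa> \<partial>N) =
     (\<integral>\<^sup>+x. ennreal (exp (s * min x n)) * avg_exp s \<partial>N)"
    unfolding avg_exp_def by (simp add: nn_integral_cmult)
  also have "\<dots> = (\<integral>\<^sup>+x. ennreal (exp (s * min x n)) \<partial>N) * avg_exp s"
    by (simp add: nn_integral_multc)
  finally show ?thesis unfolding rate_def using s V_pos by (simp add: ennreal_mult mult_ac)
qed

section \<open>Volterra relations for full and truncated exponential moments\<close>

lemma exp_excess_nonneg: "0 \<le> exp z - 1 - z" for z :: real
  using exp_ge_add_one_self[of z] by linarith

lemma integrable_min: "integrable N (\<lambda>x. min x n)"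
proof (rule Bochner_Integration.integrable_bound)
  show "integrable N (\<lambda>x. \<bar>x\<bar> + \<bar>n\<bar>)" using integrable_N by (intro Bochner_Integration.integrable_add) auto
qed (auto simp: min_def)

lemma one_plus_nn_integral:
  assumes [measurable]: "g \<in> borel_measurable N" and "\<And>x. 0 \<le> g x"
  shows "1 + (\<integral>\<^sup>+x. ennreal (g x) \<partial>N) = (\<integral>\<^sup>+x. ennreal (1 + g x) \<partial>N)"
  using assms(2) N.emeasure_space_1 by (simp add: nn_integral_add)

text \<open>Integrating \<open>exp_times_rate\<close> over s and exchanging the integrals by Tonelli
  produces exp (t x) - 1 - t x. The constant is restored by total mass one, the linear term by the
  mean zero.\<close>

lemma exp_volterra:
  assumes "0 \<le> t"
  shows "(\<integral>\<^sup>+x. ennreal (exp (t * x)) \<partial>N) =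
    1 + (\<integral>\<^sup>+s\<in>{0..t}. (\<integral>\<^sup>+x. ennreal (exp (s * x)) \<partial>N) * rate s \<partial>lborel)"
proof -
  have "(\<integral>\<^sup>+s\<in>{0..t}. (\<integral>\<^sup>+x. ennreal (exp (s * x)) \<partial>N) * rate s \<partial>lborel) =
     (\<integral>\<^sup>+s. \<integral>\<^sup>+x. ennreal (x * (exp (s * x) - 1)) * indicator {0..t} s \<partial>N \<partial>lborel)"
    by (intro nn_integral_cong) (auto simp: exp_times_rate nn_integral_multc indicator_def)
  also have "\<dots> = (\<integral>\<^sup>+x. \<integral>\<^sup>+s. ennreal (x * (exp (s * x) - 1)) * indicator {0..t} s \<partial>lborel \<partial>N)"
    by (rule lborel_N.Fubini'[symmetric]) measurable
  also have "\<dots> = (\<integral>\<^sup>+x. ennreal (exp (t * x) - 1 - t * x) \<partial>N)"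
    using assms by (simp add: nn_integral_exp_excess)
  finally have eq: "1 + (\<integral>\<^sup>+s\<in>{0..t}. (\<integral>\<^sup>+x. ennreal (exp (s * x)) \<partial>N) * rate s \<partial>lborel) =
     (\<integral>\<^sup>+x. ennreal (exp (t * x) - t * x) \<partial>N)"
    using one_plus_nn_integral[of "\<lambda>x. exp (t * x) - 1 - t * x"] exp_excess_nonneg by simp
  have i: "integrable N (\<lambda>x. t * x)" "(\<integral>x. t * x \<partial>N) = 0" using integrable_N mean_N by auto
  have pos: "0 \<le> exp (t * x) - t * x" for x using exp_excess_nonneg[of "t * x"] by linarith
  \<comment> \<open>The linear term is removed by two inequalities, with t x and with -t x, because
    both sides may be infinite.\<close>
  have "(\<integral>\<^sup>+x. ennreal (exp (t * x)) \<partial>N) \<le> (\<integral>\<^sup>+x. ennreal (exp (t * x) - t * x) \<partial>N)"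
    using i pos by (intro nn_integral_le_diff) auto
  moreover have "(\<integral>\<^sup>+x. ennreal (exp (t * x) - t * x) \<partial>N) \<le> (\<integral>\<^sup>+x. ennreal (exp (t * x) - t * x - - (t * x)) \<partial>N)"
    using i pos by (intro nn_integral_le_diff) auto
  ultimately show ?thesis using eq by simp
qed

text \<open>Here only an inequality remains: truncation from above makes the mean nonpositive, and
  this is the sign that allows the linear term to be dropped.\<close>

lemma truncated_exp_volterra:
  assumes "0 \<le> t" "0 \<le> n"
  shows "(\<integral>\<^sup>+x. ennreal (exp (t * min x n)) \<partial>N) \<le>
    1 + (\<integral>\<^sup>+s\<in>{0..t}. (\<integral>\<^sup>+x. ennreal (exp (s * min x n)) \<partial>N) * rate s \<partial>lborel)"
proof -
  have "(\<integral>\<^sup>+x. ennreal (exp (t * min x n) - 1 - t * min x n) \<partial>N) =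
     (\<integral>\<^sup>+x. \<integral>\<^sup>+s. ennreal (min x n * (exp (s * min x n) - 1)) * indicator {0..t} s \<partial>lborel \<partial>N)"
    using assms by (simp add: nn_integral_exp_excess)
  also have "\<dots> = (\<integral>\<^sup>+s. \<integral>\<^sup>+x. ennreal (min x n * (exp (s * min x n) - 1)) * indicator {0..t} s \<partial>N \<partial>lborel)"
    by (rule lborel_N.Fubini') measurable
  also have "\<dots> \<le> (\<integral>\<^sup>+s\<in>{0..t}. (\<integral>\<^sup>+x. ennreal (exp (s * min x n)) \<partial>N) * rate s \<partial>lborel)"
    using assms by (intro nn_integral_mono) (auto simp: truncated_exp_times_rate nn_integral_multc indicator_def)
  finally have "1 + (\<integral>\<^sup>+x. ennreal (exp (t * min x n) - 1 - t * min x n) \<partial>N) \<le>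
     1 + (\<integral>\<^sup>+s\<in>{0..t}. (\<integral>\<^sup>+x. ennreal (exp (s * min x n)) \<partial>N) * rate s \<partial>lborel)" by (rule add_left_mono)
  moreover have "1 + (\<integral>\<^sup>+x. ennreal (exp (t * min x n) - 1 - t * min x n) \<partial>N) =
     (\<integral>\<^sup>+x. ennreal (exp (t * min x n) - t * min x n) \<partial>N)"
    using one_plus_nn_integral[of "\<lambda>x. exp (t * min x n) - 1 - t * min x n"] exp_excess_nonneg by simp
  moreover have "(\<integral>\<^sup>+x. ennreal (exp (t * min x n)) \<partial>N) \<le> (\<integral>\<^sup>+x. ennreal (exp (t * min x n) - t * min x n) \<partial>N)"
  proof (rule nn_integral_le_diff)
    have "(\<integral>x. min x n \<partial>N) \<le> (\<integral>x. x \<partial>N)"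
      by (intro integral_mono integrable_min integrable_N) auto
    then show "(\<integral>x. t * min x n \<partial>N) \<le> 0" using mean_N assms by (simp add: mult_nonneg_nonpos)
    show "0 \<le> exp (t * min x n) - t * min x n" for x using exp_excess_nonneg[of "t * min x n"] by linarith
  qed (auto intro!: integrable_mult_right integrable_min)
  ultimately show ?thesis by simp
qed

text \<open>A finite moment gives a finite \<open>cgf\<close> and the lower bound, directly from the
  Volterra equation. A finite \<open>cgf\<close> gives the upper bound for every truncation level
  and then, by Fatou, in the limit. Together these also show that the two sides are infinite
  simultaneously.\<close>

theorem mgf_eq_exp_cgf:
  assumes t: "0 \<le> t"
  shows "(\<integral>\<^sup>+x. ennreal (exp (t * x)) \<partial>N) = (if cgf t = \<infinity> then \<infinity> else ennreal (exp (enn2real (cgf t))))"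
proof -
  define F where "F s = (\<integral>\<^sup>+x. ennreal (exp (s * x)) \<partial>N)" for s
  have [measurable]: "F \<in> borel_measurable borel" unfolding F_def by measurable
  have eq: "F s = 1 + (\<integral>\<^sup>+r\<in>{0..s}. F r * rate r \<partial>lborel)" if "0 \<le> s" for s
    unfolding F_def using that by (rule exp_volterra)
  have lower: "cgf t < \<infinity> \<and> ennreal (exp (enn2real (cgf t))) \<le> F t" if "F t < \<infinity>"
    using volterra_lower[of rate F t] that t eq unfolding cgf_def by auto
  have upper: "F t \<le> ennreal (exp (enn2real (cgf t)))" if K: "cgf t < \<infinity>"
  proof -
    have trunc: "(\<integral>\<^sup>+x. ennreal (exp (t * min x (real n))) \<partial>N) \<le> ennreal (exp (enn2real (cgf t)))" for n
      unfolding cgf_def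
    \<comment> \<open>The constant exp (t n) bounds all truncated moments on [0, t]; it does not
      occur in the resulting estimate, so n can tend to infinity.\<close>
    proof (rule volterra_upper[of rate "\<lambda>s. \<integral>\<^sup>+x. ennreal (exp (s * min x (real n))) \<partial>N" t "exp (t * real n)"])
      fix s assume s: "0 \<le> s" "s \<le> t"
      show "(\<integral>\<^sup>+x. ennreal (exp (s * min x (real n))) \<partial>N) \<le>
        1 + (\<integral>\<^sup>+r\<in>{0..s}. (\<integral>\<^sup>+x. ennreal (exp (r * min x (real n))) \<partial>N) * rate r \<partial>lborel)"
        using s by (intro truncated_exp_volterra) auto
      have "s * min x (real n) \<le> t * real n" for x
      proof -
        have "s * min x (real n) \<le> s * real n" using s by (intro mult_left_mono) auto
        also have "\<dots> \<le> t * real n" using s by (intro mult_right_mono) auto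
        finally show ?thesis .
      qed
      then have "(\<integral>\<^sup>+x. ennreal (exp (s * min x (real n))) \<partial>N) \<le> (\<integral>\<^sup>+x. ennreal (exp (t * real n)) \<partial>N)"
        by (intro nn_integral_mono ennreal_leI) auto
      then show "(\<integral>\<^sup>+x. ennreal (exp (s * min x (real n))) \<partial>N) \<le> ennreal (exp (t * real n))"
        using N.emeasure_space_1 by simp
    qed (use t K in \<open>auto simp: cgf_def\<close>)
    \<comment> \<open>For fixed x the truncation is inactive as soon as n >= x, so the integrand is
      the limit of an eventually constant sequence.\<close>
    have "F t \<le> (\<integral>\<^sup>+x. liminf (\<lambda>n. ennreal (exp (t * min x (real n)))) \<partial>N)"
      unfolding F_def
    proof (intro nn_integral_mono)
      fix x :: real
      have "\<forall>\<^sub>F n in sequentially. ennreal (exp (t * min x (real n))) = ennreal (exp (t * x))"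
        using eventually_ge_at_top[of "nat \<lceil>x\<rceil>"] by eventually_elim (auto simp: min_def nat_ceiling_le_eq)
      then have "(\<lambda>n. ennreal (exp (t * min x (real n)))) \<longlonglongrightarrow> ennreal (exp (t * x))"
        by (rule tendsto_eventually)
      from lim_imp_Liminf[OF trivial_limit_sequentially this]
      show "ennreal (exp (t * x)) \<le> liminf (\<lambda>n. ennreal (exp (t * min x (real n))))"
        by (simp only: order_refl)
    qed
    also have "\<dots> \<le> liminf (\<lambda>n. \<integral>\<^sup>+x. ennreal (exp (t * min x (real n))) \<partial>N)"
      by (intro nn_integral_liminf) measurable
    also have "\<dots> \<le> ennreal (exp (enn2real (cgf t)))"
      by (rule Liminf_le) (auto simp: trunc)
    finally show ?thesis .
  qed
  show ?thesis
    using lower upper unfolding F_def[symmetric] by (cases "F t = \<infinity>") (auto simp: less_top top_unique intro: antisym)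
qed

text \<open>After multiplication by y^2 both sides equal the Taylor remainder exp (t y) - 1 - t y.
  The case y = 0, where y^2 cannot be cancelled, is computed directly and gives t^2 / 2 on both
  sides.\<close>

lemma mult_nn_integral_beta_exp:
  assumes t: "0 \<le> t"
  shows "ennreal (t\<^sup>2 / 2) * (\<integral>\<^sup>+b. ennreal (exp (t * (b * y))) \<partial>beta_1_2) =
    (\<integral>\<^sup>+s\<in>{0..t}. ennreal s * (\<integral>\<^sup>+u\<in>{0..1}. ennreal (exp (s * (u * y))) \<partial>lborel) \<partial>lborel)"
proof -
  have beta: "(\<integral>\<^sup>+b. ennreal (exp (t * (b * y))) \<partial>beta_1_2) =
     (\<integral>\<^sup>+b\<in>{0..1}. ennreal (2 * (1 - b) * exp (t * (b * y))) \<partial>lborel)"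
    by (rule nn_integral_beta_1_2) auto
  show ?thesis
  proof (cases "t = 0")
    case True
    then have "(\<integral>\<^sup>+s\<in>{0..t}. ennreal s * (\<integral>\<^sup>+u\<in>{0..1}. ennreal (exp (s * (u * y))) \<partial>lborel) \<partial>lborel) = 0"
      by (simp add: nn_integral_indicator_singleton)
    with True show ?thesis by simp
  next
    case False
    then have t: "0 < t" using t by simp
    show ?thesis
    proof (cases "y = 0")
      case True
      have "(\<integral>\<^sup>+b. ennreal (2 * (1 - b)) * indicator {0..1} b \<partial>lborel) = ennreal ((2 * 1 - 1\<^sup>2) - (2 * 0 - 0\<^sup>2))"
        by (intro nn_integral_FTC_Icc) (auto intro!: derivative_eq_intros)
      moreover have "(\<integral>\<^sup>+s. ennreal s * indicator {0..t} s \<partial>lborel) = ennreal (t\<^sup>2 / 2 - 0\<^sup>2 / 2)"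
        using t by (intro nn_integral_FTC_Icc) (auto intro!: derivative_eq_intros)
      ultimately show ?thesis using True beta by simp
    next
      case False
      have half_nonneg: "0 \<le> t\<^sup>2 / 2" by simp
      \<comment> \<open>Antiderivative of 2 (1 - b) exp (t b y) found by integration by
        parts.\<close>
      let ?F = "\<lambda>b. 2 * (1 - b) * exp (t * (b * y)) / (t * y) + 2 * exp (t * (b * y)) / (t * y)\<^sup>2"
      have "(\<integral>\<^sup>+b. ennreal (2 * (1 - b) * exp (t * (b * y))) * indicator {0..1} b \<partial>lborel) = ennreal (?F 1 - ?F 0)"
        by (intro nn_integral_FTC_Icc)
          (use t False in \<open>auto intro!: derivative_eq_intros simp: field_simps power2_eq_square\<close>)
      then have "ennreal (y\<^sup>2) * (ennreal (t\<^sup>2 / 2) * (\<integral>\<^sup>+b. ennreal (exp (t * (b * y))) \<partial>beta_1_2)) = ennreal (y\<^sup>2 * (t\<^sup>2 / 2 * (?F 1 - ?F 0)))"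
        unfolding beta by (simp only: ennreal_mult'[OF zero_le_power2] ennreal_mult'[of "t\<^sup>2 / 2"] half_nonneg)
      also have "y\<^sup>2 * (t\<^sup>2 / 2 * (?F 1 - ?F 0)) = exp (t * y) - 1 - t * y"
        using t False by (simp add: field_simps power2_eq_square)
      also have "ennreal (exp (t * y) - 1 - t * y) = (\<integral>\<^sup>+s\<in>{0..t}. ennreal (s * y\<^sup>2) * (\<integral>\<^sup>+u\<in>{0..1}. ennreal (exp (s * (u * y))) \<partial>lborel) \<partial>lborel)"
        using t by (subst nn_integral_exp_excess[symmetric])
          (auto intro!: nn_integral_cong simp: nn_integral_exp_scaled split: split_indicator)
      also have "\<dots> = (\<integral>\<^sup>+s. ennreal (y\<^sup>2) * (ennreal s * (\<integral>\<^sup>+u\<in>{0..1}. ennreal (exp (s * (u * y))) \<partial>lborel) * indicator {0..t} s) \<partial>lborel)"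
        by (intro nn_integral_cong) (auto simp: indicator_def ennreal_mult mult_ac)
      also have "\<dots> = ennreal (y\<^sup>2) * (\<integral>\<^sup>+s\<in>{0..t}. ennreal s * (\<integral>\<^sup>+u\<in>{0..1}. ennreal (exp (s * (u * y))) \<partial>lborel) \<partial>lborel)"
        by (rule nn_integral_cmult) measurable
      finally show ?thesis using False by (simp add: ennreal_mult_cancel_left)
    qed
  qed
qed

text \<open>Tonelli moves the integral over s inside that over y, where the identity for B applies
  for each fixed y.\<close>

theorem cgf_eq_remainder:
  assumes t: "0 \<le> t"
  shows "cgf t = ennreal (V * t\<^sup>2 / 2) * (\<integral>\<^sup>+y. \<integral>\<^sup>+b. ennreal (exp (t * (b * y))) \<partial>beta_1_2 \<partial>\<kappa>)"
proof -
  interpret b: prob_space beta_1_2 by (rule prob_space_beta_1_2)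
  have "cgf t = (\<integral>\<^sup>+s. \<integral>\<^sup>+y. ennreal V * (ennreal s * (\<integral>\<^sup>+u\<in>{0..1}. ennreal (exp (s * (u * y))) \<partial>lborel) * indicator {0..t} s) \<partial>\<kappa> \<partial>lborel)"
    unfolding cgf_def rate_def avg_exp_def using V_pos
    by (intro nn_integral_cong) (auto simp: indicator_def nn_integral_cmult ennreal_mult mult.assoc)
  also have "\<dots> = (\<integral>\<^sup>+y. \<integral>\<^sup>+s. ennreal V * (ennreal s * (\<integral>\<^sup>+u\<in>{0..1}. ennreal (exp (s * (u * y))) \<partial>lborel) * indicator {0..t} s) \<partial>lborel \<partial>\<kappa>)"
    by (rule lborel_\<kappa>.Fubini'[symmetric]) measurable
  also have "\<dots> = (\<integral>\<^sup>+y. ennreal (V * t\<^sup>2 / 2) * (\<integral>\<^sup>+b. ennreal (exp (t * (b * y))) \<partial>beta_1_2) \<partial>\<kappa>)"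
  proof (intro nn_integral_cong)
    fix y
    have "(\<integral>\<^sup>+s. ennreal V * (ennreal s * (\<integral>\<^sup>+u\<in>{0..1}. ennreal (exp (s * (u * y))) \<partial>lborel) * indicator {0..t} s) \<partial>lborel) =
      ennreal V * (ennreal (t\<^sup>2 / 2) * (\<integral>\<^sup>+b. ennreal (exp (t * (b * y))) \<partial>beta_1_2))"
      unfolding mult_nn_integral_beta_exp[OF t] by (rule nn_integral_cmult) measurable
    then show "(\<integral>\<^sup>+s. ennreal V * (ennreal s * (\<integral>\<^sup>+u\<in>{0..1}. ennreal (exp (s * (u * y))) \<partial>lborel) * indicator {0..t} s) \<partial>lborel) =
      ennreal (V * t\<^sup>2 / 2) * (\<integral>\<^sup>+b. ennreal (exp (t * (b * y))) \<partial>beta_1_2)"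
      using V_pos by (simp add: ennreal_mult mult.assoc flip: times_divide_eq_right)
  qed
  also have "\<dots> = ennreal (V * t\<^sup>2 / 2) * (\<integral>\<^sup>+y. \<integral>\<^sup>+b. ennreal (exp (t * (b * y))) \<partial>beta_1_2 \<partial>\<kappa>)"
    by (rule nn_integral_cmult) measurable
  finally show ?thesis .
qed

text \<open>The weight x^2 is even, so the identity for f on the reflected laws is the original
  identity for r \<mapsto> f(-r).\<close>

lemma reflected: "zero_bias (distr N borel uminus) (distr \<kappa> borel uminus) V"
proof (rule zero_bias.intro)
  note mN = uminus_measurable[OF sets_N] and m\<kappa> = uminus_measurable[OF sets_\<kappa>]
  show "prob_space (distr N borel uminus)" by (rule N.prob_space_distr[OF mN])
  show "prob_space (distr \<kappa> borel uminus)" by (rule \<kappa>.prob_space_distr[OF m\<kappa>])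
  show "integrable (distr N borel uminus) (\<lambda>x. x)"
    by (rule integrable_distr_eq[OF mN, THEN iffD2]) (measurable, rule Bochner_Integration.integrable_minus[OF integrable_N])
  show "(\<integral>x. x \<partial>distr N borel uminus) = 0"
  proof -
    have "(\<integral>x. x \<partial>distr N borel uminus) = (\<integral>x. - x \<partial>N)"
      by (rule integral_distr[OF mN]) measurable
    also have "\<dots> = - (\<integral>x. x \<partial>N)" by (rule Bochner_Integration.integral_minus)
    finally show ?thesis by (simp only: mean_N minus_zero)
  qed
  show "(\<integral>\<^sup>+x. ennreal (x\<^sup>2) * (\<integral>\<^sup>+u\<in>{0..1}. f (u * x) \<partial>lborel) \<partial>distr N borel uminus) =
     ennreal V * (\<integral>\<^sup>+x. \<integral>\<^sup>+y. (\<integral>\<^sup>+u\<in>{0..1}. f (x + u * y) \<partial>lborel) \<partial>distr \<kappa> borel uminus \<partial>distr N borel uminus)"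
    if [measurable]: "f \<in> borel_measurable borel" for f :: "real \<Rightarrow> ennreal"
  proof -
    have y: "(\<integral>\<^sup>+y. (\<integral>\<^sup>+u\<in>{0..1}. f (x + u * y) \<partial>lborel) \<partial>distr \<kappa> borel uminus) =
      (\<integral>\<^sup>+y. (\<integral>\<^sup>+u\<in>{0..1}. f (x + u * (- y)) \<partial>lborel) \<partial>\<kappa>)" for x
      by (rule nn_integral_distr[OF m\<kappa>]) measurable
    have f': "(\<lambda>x. f (- x)) \<in> borel_measurable borel" by measurable
    have "(\<integral>\<^sup>+x. ennreal (x\<^sup>2) * (\<integral>\<^sup>+u\<in>{0..1}. f (u * x) \<partial>lborel) \<partial>distr N borel uminus) =
      (\<integral>\<^sup>+x. ennreal ((- x)\<^sup>2) * (\<integral>\<^sup>+u\<in>{0..1}. f (u * (- x)) \<partial>lborel) \<partial>N)"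
      by (rule nn_integral_distr[OF mN]) measurable
    also have "\<dots> = (\<integral>\<^sup>+x. ennreal (x\<^sup>2) * (\<integral>\<^sup>+u\<in>{0..1}. f (- (u * x)) \<partial>lborel) \<partial>N)"
      by (simp only: power2_minus mult_minus_right)
    also have "\<dots> = ennreal V * (\<integral>\<^sup>+x. \<integral>\<^sup>+y. (\<integral>\<^sup>+u\<in>{0..1}. f (- (x + u * y)) \<partial>lborel) \<partial>\<kappa> \<partial>N)"
      by (rule biased[OF f'])
    also have "\<dots> = ennreal V * (\<integral>\<^sup>+x. \<integral>\<^sup>+y. (\<integral>\<^sup>+u\<in>{0..1}. f (- x + u * (- y)) \<partial>lborel) \<partial>\<kappa> \<partial>N)"
      by (simp only: minus_add_distrib mult_minus_right)
    also have "(\<integral>\<^sup>+x. \<integral>\<^sup>+y. (\<integral>\<^sup>+u\<in>{0..1}. f (- x + u * (- y)) \<partial>lborel) \<partial>\<kappa> \<partial>N) =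
      (\<integral>\<^sup>+x. \<integral>\<^sup>+y. (\<integral>\<^sup>+u\<in>{0..1}. f (x + u * (- y)) \<partial>lborel) \<partial>\<kappa> \<partial>distr N borel uminus)"
      by (rule nn_integral_distr[OF mN, symmetric]) measurable
    finally show ?thesis by (simp only: y)
  qed
qed (rule V_pos sets_distr)+

end

section \<open>The canonical law\<close>

locale finite_levy_moment =
  fixes a :: real and \<nu> :: "real measure" and V :: real
  assumes a_nonneg: "0 \<le> a" and sets_\<nu>[measurable_cong]: "sets \<nu> = sets borel"
    and square_integrable: "integrable \<nu> (\<lambda>x. x\<^sup>2)"
    and V_eq: "V = a + (\<integral>x. x\<^sup>2 \<partial>\<nu>)" and V_pos: "0 < V"
begin

lemma total_mass: "ennreal a + (\<integral>\<^sup>+x. ennreal (x\<^sup>2) \<partial>\<nu>) = ennreal V"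
  using a_nonneg by (simp add: nn_integral_eq_integral[OF square_integrable] V_eq)

text \<open>\<open>measure_of\<close> returns the prescribed set function only if it is countably
  additive. This is inherited from its two summands, a scaled Dirac measure and a measure with
  density x^2.\<close>

lemma emeasure_canonical_law:
  assumes "A \<in> sets borel"
  shows "emeasure (canonical_law a \<nu>) A = (ennreal a * indicator A 0 + (\<integral>\<^sup>+x\<in>A. ennreal (x\<^sup>2) \<partial>\<nu>)) / ennreal V"
  unfolding canonical_law_def total_mass
proof (rule emeasure_measure_of_sigma)
  let ?S1 = "scale_measure (ennreal a) (return borel (0::real))" and ?S2 = "density \<nu> (\<lambda>x. ennreal (x\<^sup>2))"
  let ?\<mu> = "\<lambda>A. (ennreal a * indicator A 0 + (\<integral>\<^sup>+x\<in>A. ennreal (x\<^sup>2) \<partial>\<nu>)) / ennreal V"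
  have \<mu>: "?\<mu> A = (emeasure ?S1 A + emeasure ?S2 A) * inverse (ennreal V)" if "A \<in> sets borel" for A
    using that by (simp add: emeasure_density divide_ennreal_def sets_\<nu>)
  show "countably_additive (sets borel) ?\<mu>"
  proof (rule countably_additiveI)
    fix A :: "nat \<Rightarrow> real set" assume A: "range A \<subseteq> sets borel" "disjoint_family A" "\<Union> (range A) \<in> sets borel"
    have "(\<Sum>i. ?\<mu> (A i)) = (\<Sum>i. (emeasure ?S1 (A i) + emeasure ?S2 (A i)) * inverse (ennreal V))"
      using A by (intro suminf_cong \<mu>) auto
    also have "\<dots> = ((\<Sum>i. emeasure ?S1 (A i)) + (\<Sum>i. emeasure ?S2 (A i))) * inverse (ennreal V)"
      by (subst ennreal_suminf_multc, subst suminf_add[symmetric, OF summableI summableI]) (rule refl)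
    also have "\<dots> = ?\<mu> (\<Union> (range A))"
    proof -
      have "(\<Sum>i. emeasure ?S1 (A i)) = emeasure ?S1 (\<Union> (range A))"
        by (rule suminf_emeasure) (use A in auto)
      moreover have "(\<Sum>i. emeasure ?S2 (A i)) = emeasure ?S2 (\<Union> (range A))"
        by (rule suminf_emeasure) (use A sets_\<nu> in auto)
      ultimately show ?thesis using A(3) \<mu>[of "\<Union> (range A)"] by presburger
    qed
    finally show "(\<Sum>i. ?\<mu> (A i)) = ?\<mu> (\<Union> (range A))" .
  qed
  show "sigma_algebra UNIV (sets (borel :: real measure))"
    using sets.sigma_algebra_axioms[of "borel :: real measure"] by simp
qed (use assms in \<open>auto simp: positive_def\<close>)

lemma sets_canonical_law[measurable_cong]: "sets (canonical_law a \<nu>) = sets borel"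
  unfolding canonical_law_def
  using sets.sigma_sets_eq[of "borel :: real measure"] by (subst sets_measure_of) auto

lemma space_canonical_law[simp]: "space (canonical_law a \<nu>) = UNIV"
  using sets_eq_imp_space_eq[OF sets_canonical_law] by simp

lemma prob_space_canonical_law: "prob_space (canonical_law a \<nu>)"
proof
  show "emeasure (canonical_law a \<nu>) (space (canonical_law a \<nu>)) = 1"
    using V_pos total_mass by (simp add: emeasure_canonical_law divide_ennreal)
qed

text \<open>The law is given by its values on sets, so the formula is extended by induction over
  measurable functions.\<close>

lemma nn_integral_canonical_law:
  fixes f :: "real \<Rightarrow> ennreal"
  assumes "f \<in> borel_measurable borel"
  shows "(\<integral>\<^sup>+x. f x \<partial>canonical_law a \<nu>) = (ennreal a * f 0 + (\<integral>\<^sup>+x. ennreal (x\<^sup>2) * f x \<partial>\<nu>)) / ennreal V"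
  using assms
proof (induction rule: borel_measurable_induct)
  case (cong f g)
  then have "f = g" by auto
  with cong show ?case by simp
next
  case (set A)
  then show ?case
    by (simp add: emeasure_canonical_law sets_canonical_law)
next
  case (mult u c)
  have [measurable]: "u \<in> borel_measurable borel" by fact
  have "(\<integral>\<^sup>+x. ennreal (x\<^sup>2) * (c * u x) \<partial>\<nu>) = c * (\<integral>\<^sup>+x. ennreal (x\<^sup>2) * u x \<partial>\<nu>)"
    by (subst nn_integral_cmult[symmetric]) (auto simp: mult_ac)
  then show ?case
    using mult by (simp add: nn_integral_cmult divide_ennreal_def distrib_left distrib_right mult_ac)
next
  case (add u v)
  have [measurable]: "u \<in> borel_measurable borel" "v \<in> borel_measurable borel" by fact+
  have "(\<integral>\<^sup>+x. ennreal (x\<^sup>2) * (u x + v x) \<partial>\<nu>) = (\<integral>\<^sup>+x. ennreal (x\<^sup>2) * u x \<partial>\<nu>) + (\<integral>\<^sup>+x. ennreal (x\<^sup>2) * v x \<partial>\<nu>)"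
    by (subst nn_integral_add[symmetric]) (auto simp: distrib_left)
  moreover have "(\<integral>\<^sup>+x. v x + u x \<partial>canonical_law a \<nu>) = (\<integral>\<^sup>+x. v x \<partial>canonical_law a \<nu>) + (\<integral>\<^sup>+x. u x \<partial>canonical_law a \<nu>)"
    by (rule nn_integral_add) auto
  ultimately show ?case
    using add by (simp add: divide_ennreal_def distrib_left distrib_right add_ac)
next
  case (seq U)
  have [measurable]: "U i \<in> borel_measurable borel" for i by fact
  have inc: "incseq (\<lambda>i. ennreal (x\<^sup>2) * U i x)" for x
    using seq by (auto simp: incseq_def le_fun_def intro: mult_left_mono)
  have "(\<integral>\<^sup>+x. (SUP i. U i) x \<partial>canonical_law a \<nu>) = (SUP i. \<integral>\<^sup>+x. U i x \<partial>canonical_law a \<nu>)"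
    using seq unfolding SUP_apply image_comp by (subst nn_integral_monotone_convergence_SUP) (auto)
  also have "\<dots> = (SUP i. (ennreal a * U i 0 + (\<integral>\<^sup>+x. ennreal (x\<^sup>2) * U i x \<partial>\<nu>)) * inverse (ennreal V))"
    using seq by (simp add: divide_ennreal_def)
  also have "\<dots> = (SUP i. ennreal a * U i 0 + (\<integral>\<^sup>+x. ennreal (x\<^sup>2) * U i x \<partial>\<nu>)) * inverse (ennreal V)"
    by (simp add: SUP_mult_right_ennreal)
  also have "(SUP i. ennreal a * U i 0 + (\<integral>\<^sup>+x. ennreal (x\<^sup>2) * U i x \<partial>\<nu>)) =
     (SUP i. ennreal a * U i 0) + (SUP i. \<integral>\<^sup>+x. ennreal (x\<^sup>2) * U i x \<partial>\<nu>)"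
    using seq inc by (intro ennreal_SUP_add)
     (auto simp: incseq_def le_fun_def intro!: mult_left_mono nn_integral_mono)
  also have "(SUP i. ennreal a * U i 0) = ennreal a * (SUP i. U i) 0"
    by (simp add: SUP_mult_left_ennreal image_comp)
  also have "(SUP i. \<integral>\<^sup>+x. ennreal (x\<^sup>2) * U i x \<partial>\<nu>) = (\<integral>\<^sup>+x. (SUP i. ennreal (x\<^sup>2) * U i x) \<partial>\<nu>)"
    using inc by (intro nn_integral_monotone_convergence_SUP[symmetric]) (auto simp: incseq_def le_fun_def)
  also have "\<dots> = (\<integral>\<^sup>+x. ennreal (x\<^sup>2) * (SUP i. U i) x \<partial>\<nu>)"
    by (simp add: SUP_mult_left_ennreal image_comp)
  finally show ?case by (simp add: divide_ennreal_def)
qed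

sublocale canonical: prob_space "canonical_law a \<nu>" by (rule prob_space_canonical_law)

lemma integrable_square_mult:
  fixes f :: "real \<Rightarrow> 'b::{banach, second_countable_topology, real_normed_algebra}"
  assumes [measurable]: "f \<in> borel_measurable borel" and "\<And>x. norm (f x) \<le> B"
  shows "integrable \<nu> (\<lambda>x. x\<^sup>2 *\<^sub>R f x)"
proof (rule Bochner_Integration.integrable_bound)
  show "integrable \<nu> (\<lambda>x. B * x\<^sup>2)" using square_integrable by simp
  have "norm (x\<^sup>2 *\<^sub>R f x) \<le> norm (B * x\<^sup>2)" for x
    using mult_left_mono[OF assms(2), of "x\<^sup>2" x] by (simp add: mult.commute abs_mult order_trans[OF _ mult_right_mono[OF abs_ge_self]])
  then show "AE x in \<nu>. norm (x\<^sup>2 *\<^sub>R f x) \<le> norm (B * x\<^sup>2)" by simp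
qed measurable

lemma integral_canonical_law_nonneg:
  fixes f :: "real \<Rightarrow> real"
  assumes [measurable]: "f \<in> borel_measurable borel" and bound: "\<And>x. 0 \<le> f x" "\<And>x. f x \<le> B"
  shows "V * (\<integral>x. f x \<partial>canonical_law a \<nu>) = a * f 0 + (\<integral>x. x\<^sup>2 * f x \<partial>\<nu>)"
proof -
  have int: "integrable \<nu> (\<lambda>x. x\<^sup>2 * f x)"
    using integrable_square_mult[of f B] bound by simp
  have "ennreal (\<integral>x. f x \<partial>canonical_law a \<nu>) = (\<integral>\<^sup>+x. ennreal (f x) \<partial>canonical_law a \<nu>)"
    using bound by (intro nn_integral_eq_integral[symmetric] canonical.integrable_const_bound[where B=B]) auto
  also have "\<dots> = (ennreal a * ennreal (f 0) + (\<integral>\<^sup>+x. ennreal (x\<^sup>2 * f x) \<partial>\<nu>)) / ennreal V"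
    by (subst nn_integral_canonical_law) (auto simp: ennreal_mult bound)
  also have "(\<integral>\<^sup>+x. ennreal (x\<^sup>2 * f x) \<partial>\<nu>) = ennreal (\<integral>x. x\<^sup>2 * f x \<partial>\<nu>)"
    using bound int by (intro nn_integral_eq_integral) auto
  also have "(ennreal a * ennreal (f 0) + ennreal (\<integral>x. x\<^sup>2 * f x \<partial>\<nu>)) / ennreal V = ennreal ((a * f 0 + (\<integral>x. x\<^sup>2 * f x \<partial>\<nu>)) / V)"
    using a_nonneg bound V_pos by (simp add: divide_ennreal[symmetric] ennreal_mult)
  finally have "(\<integral>x. f x \<partial>canonical_law a \<nu>) = (a * f 0 + (\<integral>x. x\<^sup>2 * f x \<partial>\<nu>)) / V"
    using a_nonneg bound V_pos by (subst (asm) ennreal_inj) (auto intro!: divide_nonneg_nonneg add_nonneg_nonneg integral_nonneg_AE)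
  then show ?thesis using V_pos by simp
qed

text \<open>Adding the constant \<open>B\<close> reduces to the nonnegative case. The added terms a
  B and (V - a) B on the right sum to V B and cancel with the left, because the total mass before
  normalization is V.\<close>

lemma integral_canonical_law_real:
  fixes f :: "real \<Rightarrow> real"
  assumes [measurable]: "f \<in> borel_measurable borel" and bound: "\<And>x. \<bar>f x\<bar> \<le> B"
  shows "V * (\<integral>x. f x \<partial>canonical_law a \<nu>) = a * f 0 + (\<integral>x. x\<^sup>2 * f x \<partial>\<nu>)"
proof -
  have int: "integrable \<nu> (\<lambda>x. x\<^sup>2 * f x)"
    using integrable_square_mult[of f B] bound by simp
  have int': "integrable (canonical_law a \<nu>) f"
    using bound by (intro canonical.integrable_const_bound[where B=B]) auto
  have fB: "0 \<le> f x + B" "f x + B \<le> 2 * B" for x using bound[of x] by auto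
  have "V * (\<integral>x. f x + B \<partial>canonical_law a \<nu>) = a * (f 0 + B) + (\<integral>x. x\<^sup>2 * (f x + B) \<partial>\<nu>)"
    using fB by (intro integral_canonical_law_nonneg[of _ "2 * B"]) auto
  also have "(\<integral>x. x\<^sup>2 * (f x + B) \<partial>\<nu>) = (\<integral>x. x\<^sup>2 * f x \<partial>\<nu>) + (V - a) * B"
    using int square_integrable by (simp add: distrib_left V_eq)
  finally show ?thesis using int' canonical.prob_space by (simp add: algebra_simps)
qed

lemma integral_canonical_law:
  fixes f :: "real \<Rightarrow> complex"
  assumes [measurable]: "f \<in> borel_measurable borel" and bound: "\<And>x. norm (f x) \<le> B"
  shows "V * (\<integral>x. f x \<partial>canonical_law a \<nu>) = a * f 0 + (\<integral>x. x\<^sup>2 *\<^sub>R f x \<partial>\<nu>)"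
proof -
  have int: "integrable \<nu> (\<lambda>x. x\<^sup>2 *\<^sub>R f x)"
    by (rule integrable_square_mult) (use bound in auto)
  have int': "integrable (canonical_law a \<nu>) f"
    using bound by (intro canonical.integrable_const_bound[where B=B]) auto
  have b: "\<bar>Re (f x)\<bar> \<le> B" "\<bar>Im (f x)\<bar> \<le> B" for x
    using bound[of x] abs_Re_le_cmod[of "f x"] abs_Im_le_cmod[of "f x"] by auto
  from integral_canonical_law_real[of "\<lambda>x. Re (f x)", OF _ b(1)] integral_canonical_law_real[of "\<lambda>x. Im (f x)", OF _ b(2)]
  show ?thesis
    using integral_Re[OF int'] integral_Im[OF int'] integral_Re[OF int] integral_Im[OF int]
    by (simp add: complex_eq_iff)
qed

end

section \<open>Characteristic functions\<close>

text \<open>Dominated convergence for the difference quotient minus its limit: by the mean value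
  inequality f is g(x)-Lipschitz in the parameter, so 2 g dominates.\<close>

lemma has_vector_derivative_integral:
  fixes f f' :: "real \<Rightarrow> 'a \<Rightarrow> complex"
  assumes d: "0 < d"
    and int: "\<And>s. s \<in> ball u d \<Longrightarrow> integrable M (f s)"
    and deriv: "\<And>s x. s \<in> ball u d \<Longrightarrow> ((\<lambda>s. f s x) has_vector_derivative f' s x) (at s)"
    and bound: "\<And>s x. s \<in> ball u d \<Longrightarrow> norm (f' s x) \<le> g x"
    and g: "integrable M g" and [measurable]: "f' u \<in> borel_measurable M"
  shows "((\<lambda>s. \<integral>x. f s x \<partial>M) has_vector_derivative (\<integral>x. f' u x \<partial>M)) (at u)"
proof -
  have u: "u \<in> ball u d" using d by simp
  have int': "integrable M (f' u)"
    by (rule Bochner_Integration.integrable_bound[OF g]) (use bound[OF u] in \<open>auto intro: order_trans[OF _ abs_ge_self]\<close>)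
  have lip: "norm (f s x - f u x) \<le> g x * norm (s - u)" if "s \<in> ball u d" for s x
  proof (rule differentiable_bound[where S="ball u d" and f'="\<lambda>s h. h *\<^sub>R f' s x"])
    fix r assume r: "r \<in> ball u d"
    show "((\<lambda>s. f s x) has_derivative (\<lambda>h. h *\<^sub>R f' r x)) (at r within ball u d)"
      using deriv[OF r] unfolding has_vector_derivative_def by (rule has_derivative_at_withinI)
    show "onorm (\<lambda>h. h *\<^sub>R f' r x) \<le> g x"
      using bound[OF r, of x] by (intro onorm_le) (simp add: mult.commute mult_left_mono)
  qed (use that u in auto)
  have "((\<lambda>s. ((\<integral>x. f s x \<partial>M) - ((\<integral>x. f u x \<partial>M) + (s - u) *\<^sub>R (\<integral>x. f' u x \<partial>M))) /\<^sub>R norm (s - u)) \<longlongrightarrow> 0) (at u within ball u d)"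
    unfolding tendsto_at_iff_sequentially comp_def
  proof (intro allI impI)
    fix X assume X: "\<forall>i. X i \<in> ball u d - {u}" "X \<longlonglongrightarrow> u"
    let ?h = "\<lambda>i x. (f (X i) x - (f u x + (X i - u) *\<^sub>R f' u x)) /\<^sub>R norm (X i - u)"
    have meas: "f (X i) \<in> borel_measurable M" "f u \<in> borel_measurable M" for i
      using int[of "X i"] int[OF u] X by auto
    have "(\<lambda>i. \<integral>x. ?h i x \<partial>M) \<longlonglongrightarrow> (\<integral>x. 0 \<partial>M)"
    proof (rule integral_dominated_convergence[where w="\<lambda>x. 2 * g x"])
      show "AE x in M. (\<lambda>i. ?h i x) \<longlonglongrightarrow> 0"
      proof (rule AE_I2)
        fix x
        have "((\<lambda>s. (f s x - (f u x + (s - u) *\<^sub>R f' u x)) /\<^sub>R norm (s - u)) \<longlongrightarrow> 0) (at u within ball u d)"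
          using has_derivative_at_withinI[OF deriv[OF u, of x, unfolded has_vector_derivative_def], where s="ball u d"]
          unfolding has_derivative_within by (simp add: divide_inverse)
        then show "(\<lambda>i. ?h i x) \<longlonglongrightarrow> 0" using X unfolding tendsto_at_iff_sequentially comp_def by blast
      qed
      show "AE x in M. norm (?h i x) \<le> 2 * g x" for i
      proof (rule AE_I2)
        fix x
        have Xi: "X i \<in> ball u d" "X i \<noteq> u" using X by auto
        have "norm (f (X i) x - (f u x + (X i - u) *\<^sub>R f' u x)) \<le> norm (f (X i) x - f u x) + norm ((X i - u) *\<^sub>R f' u x)"
          by (metis diff_diff_eq norm_triangle_ineq4)
        also have "\<dots> \<le> g x * norm (X i - u) + norm (X i - u) * g x"
          using bound[OF u, of x] by (intro add_mono lip Xi) (simp add: mult_left_mono)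
        finally have "norm (f (X i) x - (f u x + (X i - u) *\<^sub>R f' u x)) \<le> 2 * g x * norm (X i - u)" by simp
        then show "norm (?h i x) \<le> 2 * g x" using Xi
          by (simp add: pos_divide_le_eq abs_divide flip: divide_inverse_commute)
      qed
    qed (use g meas in auto)
    moreover have "(\<lambda>i. \<integral>x. ?h i x \<partial>M) = (\<lambda>i. ((\<integral>x. f (X i) x \<partial>M) - ((\<integral>x. f u x \<partial>M) + (X i - u) *\<^sub>R (\<integral>x. f' u x \<partial>M))) /\<^sub>R norm (X i - u))"
    proof
      fix i
      show "(\<integral>x. ?h i x \<partial>M) = ((\<integral>x. f (X i) x \<partial>M) - ((\<integral>x. f u x \<partial>M) + (X i - u) *\<^sub>R (\<integral>x. f' u x \<partial>M))) /\<^sub>R norm (X i - u)"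
        using int[of "X i"] int[OF u] int' X by simp
    qed
    ultimately show "(\<lambda>i. ((\<integral>x. f (X i) x \<partial>M) - ((\<integral>x. f u x \<partial>M) + (X i - u) *\<^sub>R (\<integral>x. f' u x \<partial>M))) /\<^sub>R norm (X i - u)) \<longlonglongrightarrow> 0"
      by simp
  qed
  then have "((\<lambda>s. \<integral>x. f s x \<partial>M) has_vector_derivative (\<integral>x. f' u x \<partial>M)) (at u within ball u d)"
    unfolding has_vector_derivative_def has_derivative_within by (simp add: divide_inverse bounded_linear_scaleR_left)
  then show ?thesis using u by (simp add: at_within_open[OF u open_ball])
qed

section \<open>Products with a uniform variable and independent sums: laws and characteristic
  functions\<close>

definition unit_uniform :: "real measure" where
  "unit_uniform = density lborel (\<lambda>u. ennreal (indicator {0..1} u))"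

lemma sets_unit_uniform[measurable_cong]: "sets unit_uniform = sets borel"
  by (simp add: unit_uniform_def)

lemma nn_integral_unit_uniform:
  assumes [measurable]: "f \<in> borel_measurable borel"
  shows "(\<integral>\<^sup>+u. f u \<partial>unit_uniform) = (\<integral>\<^sup>+u\<in>{0..1}. f u \<partial>lborel)"
proof -
  have "(\<integral>\<^sup>+u. f u \<partial>unit_uniform) = (\<integral>\<^sup>+u. ennreal (indicator {0..1} u) * f u \<partial>lborel)"
    unfolding unit_uniform_def by (rule nn_integral_density) measurable
  also have "\<dots> = (\<integral>\<^sup>+u\<in>{0..1}. f u \<partial>lborel)"
    by (intro nn_integral_cong) (simp split: split_indicator)
  finally show ?thesis .
qed

interpretation unit_uniform: real_distribution unit_uniform
proof -
  have "emeasure unit_uniform (space unit_uniform) = 1"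
    using nn_integral_unit_uniform[of "\<lambda>_. 1"] by simp
  then have "prob_space unit_uniform" by (rule prob_spaceI)
  then show "real_distribution unit_uniform"
    unfolding real_distribution_def real_distribution_axioms_def using sets_unit_uniform by (auto simp: unit_uniform_def)
qed

text \<open>The multiplied form avoids the removable singularity at z = 0. It turns the factor exp
  (i u x) - 1 from a differentiated characteristic function into an average over U.\<close>

lemma char_unit_uniform: "\<i> * z * char unit_uniform z = iexp z - 1"
proof (cases "z = 0")
  case False
  have "char unit_uniform z = (\<integral>u. indicator {0..1} u *\<^sub>R iexp (z * u) \<partial>lborel)"
    unfolding char_def unit_uniform_def by (subst integral_density) auto
  also have "\<dots> = iexp (z * 1) / (\<i> * z) - iexp (z * 0) / (\<i> * z)"
  proof (rule integral_FTC_Icc)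
    fix x
    have "((\<lambda>w. exp (\<i> * (z * w))) has_field_derivative (exp (\<i> * (z * complex_of_real x)) * (\<i> * z))) (at (complex_of_real x))"
      by (auto intro!: derivative_eq_intros)
    from has_vector_derivative_real_field[OF this]
    have vec: "((\<lambda>u. exp (\<i> * complex_of_real (z * u))) has_vector_derivative exp (\<i> * complex_of_real (z * x)) * (\<i> * z)) (at x within {0..1})"
      by simp
    have "((\<lambda>u. exp (\<i> * complex_of_real (z * u)) / (\<i> * z)) has_vector_derivative
      (exp (\<i> * complex_of_real (z * x)) * (\<i> * z)) / (\<i> * z)) (at x within {0..1})"
      by (intro has_vector_derivative_divide vec)
    then show "((\<lambda>u. exp (\<i> * complex_of_real (z * u)) / (\<i> * z)) has_vector_derivative iexp (z * x)) (at x within {0..1})"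
      using False by simp
  qed (auto intro!: continuous_intros)
  finally show ?thesis using False by (simp add: field_simps)
qed simp

definition uniform_scaling :: "real measure \<Rightarrow> real measure" where
  "uniform_scaling Q = distr (unit_uniform \<Otimes>\<^sub>M Q) borel (\<lambda>(u, y). u * y)"

lemma
  assumes Q: "real_distribution Q"
  shows real_distribution_uniform_scaling: "real_distribution (uniform_scaling Q)"
    and nn_integral_uniform_scaling: "f \<in> borel_measurable borel \<Longrightarrow>
      (\<integral>\<^sup>+x. f x \<partial>uniform_scaling Q) = (\<integral>\<^sup>+y. (\<integral>\<^sup>+u\<in>{0..1}. f (u * y) \<partial>lborel) \<partial>Q)"
    and char_uniform_scaling: "char (uniform_scaling Q) s = (\<integral>y. char unit_uniform (s * y) \<partial>Q)"
proof -
  interpret Q: real_distribution Q by fact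
  interpret P: pair_prob_space unit_uniform Q ..
  have [measurable_cong]: "sets Q = sets borel" by simp
  show "real_distribution (uniform_scaling Q)"
    unfolding uniform_scaling_def by (rule P.real_distribution_distr) measurable
  show "(\<integral>\<^sup>+x. f x \<partial>uniform_scaling Q) = (\<integral>\<^sup>+y. (\<integral>\<^sup>+u\<in>{0..1}. f (u * y) \<partial>lborel) \<partial>Q)"
    if [measurable]: "f \<in> borel_measurable borel"
  proof -
    have "(\<integral>\<^sup>+x. f x \<partial>uniform_scaling Q) = (\<integral>\<^sup>+z. f (fst z * snd z) \<partial>(unit_uniform \<Otimes>\<^sub>M Q))"
      unfolding uniform_scaling_def by (subst nn_integral_distr) (auto simp: case_prod_beta)
    also have "\<dots> = (\<integral>\<^sup>+y. \<integral>\<^sup>+u. f (u * y) \<partial>unit_uniform \<partial>Q)"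
      by (subst P.nn_integral_snd[symmetric]) (auto simp: case_prod_beta)
    also have "\<dots> = (\<integral>\<^sup>+y. (\<integral>\<^sup>+u\<in>{0..1}. f (u * y) \<partial>lborel) \<partial>Q)"
      by (intro nn_integral_cong nn_integral_unit_uniform) measurable
    finally show ?thesis .
  qed
  have "char (uniform_scaling Q) s = (CLINT z|(unit_uniform \<Otimes>\<^sub>M Q). iexp (s * (fst z * snd z)))"
    unfolding char_def uniform_scaling_def by (subst integral_distr) (auto simp: case_prod_beta)
  also have "\<dots> = (\<integral>y. (CLINT u|unit_uniform. iexp (s * (u * y))) \<partial>Q)"
  proof -
    have "integrable (unit_uniform \<Otimes>\<^sub>M Q) (\<lambda>(u, y). iexp (s * (u * y)))"
      by (rule P.integrable_const_bound[where B=1]) auto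
    from P.integral_snd[OF this, symmetric] show ?thesis unfolding case_prod_beta .
  qed
  also have "\<dots> = (\<integral>y. char unit_uniform (s * y) \<partial>Q)"
    unfolding char_def by (intro Bochner_Integration.integral_cong refl) (simp add: mult_ac)
  finally show "char (uniform_scaling Q) s = (\<integral>y. char unit_uniform (s * y) \<partial>Q)" .
qed

lemma
  assumes N: "real_distribution N" and Q: "real_distribution Q"
  shows real_distribution_sum: "real_distribution (distr (N \<Otimes>\<^sub>M Q) borel (\<lambda>(x, y). x + y))"
    and nn_integral_sum: "f \<in> borel_measurable borel \<Longrightarrow>
      (\<integral>\<^sup>+x. f x \<partial>distr (N \<Otimes>\<^sub>M Q) borel (\<lambda>(x, y). x + y)) = (\<integral>\<^sup>+x. \<integral>\<^sup>+y. f (x + y) \<partial>Q \<partial>N)"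
    and char_sum: "char (distr (N \<Otimes>\<^sub>M Q) borel (\<lambda>(x, y). x + y)) s = char N s * char Q s"
proof -
  interpret N: real_distribution N by fact
  interpret Q: real_distribution Q by fact
  interpret P: pair_prob_space N Q ..
  have [measurable_cong]: "sets N = sets borel" "sets Q = sets borel" by simp_all
  show "real_distribution (distr (N \<Otimes>\<^sub>M Q) borel (\<lambda>(x, y). x + y))"
    by (rule P.real_distribution_distr) measurable
  show "(\<integral>\<^sup>+x. f x \<partial>distr (N \<Otimes>\<^sub>M Q) borel (\<lambda>(x, y). x + y)) = (\<integral>\<^sup>+x. \<integral>\<^sup>+y. f (x + y) \<partial>Q \<partial>N)"
    if [measurable]: "f \<in> borel_measurable borel"
  proof -
    have "(\<integral>\<^sup>+x. f x \<partial>distr (N \<Otimes>\<^sub>M Q) borel (\<lambda>(x, y). x + y)) = (\<integral>\<^sup>+z. f (fst z + snd z) \<partial>(N \<Otimes>\<^sub>M Q))"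
      by (subst nn_integral_distr) (auto simp: case_prod_beta)
    also have "\<dots> = (\<integral>\<^sup>+x. \<integral>\<^sup>+y. f (x + y) \<partial>Q \<partial>N)"
      by (subst Q.nn_integral_fst[symmetric]) auto
    finally show ?thesis .
  qed
  have "char (distr (N \<Otimes>\<^sub>M Q) borel (\<lambda>(x, y). x + y)) s = (CLINT z|(N \<Otimes>\<^sub>M Q). iexp (s * (fst z + snd z)))"
    unfolding char_def by (subst integral_distr) (auto simp: case_prod_beta)
  also have "\<dots> = (CLINT x|N. (CLINT y|Q. iexp (s * (x + y))))"
  proof -
    have "integrable (N \<Otimes>\<^sub>M Q) (\<lambda>z. iexp (s * (fst z + snd z)))"
      by (rule P.integrable_const_bound[where B=1]) auto
    then show ?thesis by (subst P.integral_fst'[symmetric]) auto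
  qed
  also have "\<dots> = (CLINT x|N. iexp (s * x) * (CLINT y|Q. iexp (s * y)))"
    by (simp add: distrib_left exp_add del: of_real_mult)
  also have "\<dots> = char N s * char Q s" unfolding char_def by simp
  finally show "char (distr (N \<Otimes>\<^sub>M Q) borel (\<lambda>(x, y). x + y)) s = char N s * char Q s" .
qed

text \<open>By the half-angle formula 1 - cos z = 2 sin^2 (z/2). The limit is the integrand x^2 / 2
  in Fatou's lemma for the Levy measure.\<close>

lemma one_minus_cos_scaled_tendsto:
  "(\<lambda>n. (1 - cos (x / real n)) * (real n)\<^sup>2) \<longlonglongrightarrow> x\<^sup>2 / 2" for x::real
proof (cases "x = 0")
  case False
  have "((\<lambda>z. sin z / z) \<longlongrightarrow> 1) (at (0::real))" using DERIV_sin[of 0] by (simp add: has_field_derivative_iff)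
  moreover have "filterlim (\<lambda>n. x / 2 / real n) (at 0) sequentially"
    using False eventually_gt_at_top[of "0::nat"]
    by (intro filterlim_atI lim_const_over_n) (auto elim!: eventually_mono)
  ultimately have "(\<lambda>n. sin (x / 2 / real n) / (x / 2 / real n)) \<longlonglongrightarrow> 1" by (rule filterlim_compose)
  then have "(\<lambda>n. (sin (x / 2 / real n) / (x / 2 / real n))\<^sup>2 * (x\<^sup>2 / 2)) \<longlonglongrightarrow> 1\<^sup>2 * (x\<^sup>2 / 2)"
    by (intro tendsto_intros)
  moreover have "(sin (x / 2 / real n) / (x / 2 / real n))\<^sup>2 * (x\<^sup>2 / 2) = (1 - cos (x / real n)) * (real n)\<^sup>2" for n
  proof (cases "n = 0")
    case n: False
    have "cos (x / real n) = 1 - 2 * (sin (x / 2 / real n))\<^sup>2"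
      using cos_double_sin[of "x / 2 / real n"] by simp
    then have "(1 - cos (x / real n)) * (real n)\<^sup>2 = 2 * (sin (x / 2 / real n))\<^sup>2 * (real n)\<^sup>2" by simp
    also have "\<dots> = (sin (x / 2 / real n) / (x / 2 / real n))\<^sup>2 * (x\<^sup>2 / 2)"
      using False n by (simp add: power_divide power_mult_distrib)
    finally show ?thesis by simp
  qed simp
  ultimately show ?thesis by simp
qed simp

section \<open>The zero-bias identity from the Levy--Khintchine formula\<close>

text \<open>For \<bar>x\<bar> <= 1 the compensated integrand is quadratic in x, and outside it is
  bounded by 2; the factor 2 + u^2 covers both cases.\<close>

lemma iexp_diff_bound:
  "cmod (iexp (u * x) - 1 - \<i> * of_real (u * x) * indicator {-1..1} x) \<le> (2 + u\<^sup>2) * min 1 (x\<^sup>2)"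
proof (cases "x \<in> {-1..1}")
  case True
  then have "x\<^sup>2 \<le> 1" by (simp add: abs_square_le_1 abs_le_iff)
  have "cmod (iexp (u * x) - 1 - \<i> * of_real (u * x)) \<le> (u * x)\<^sup>2 / 2"
    using iexp_approx1[of "u * x" 1] by (simp add: algebra_simps power2_eq_square abs_mult numeral_2_eq_2)
  also have "\<dots> \<le> (2 + u\<^sup>2) * x\<^sup>2"
    by (simp add: power_mult_distrib distrib_right)
  finally show ?thesis using True \<open>x\<^sup>2 \<le> 1\<close> by simp
next
  case False
  then have "1 \<le> \<bar>x\<bar>" by auto
  then have "1 * 1 \<le> \<bar>x\<bar> * \<bar>x\<bar>" by (intro mult_mono) auto
  then have "1 \<le> x\<^sup>2" by (simp add: power2_eq_square flip: abs_mult)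
  have "cmod (iexp (u * x) - 1) \<le> 2"
    using norm_triangle_ineq4[of "iexp (u * x)" 1] by simp
  also have "\<dots> \<le> (2 + u\<^sup>2) * 1" by simp
  finally show ?thesis using False \<open>1 \<le> x\<^sup>2\<close> by simp
qed

text \<open>Multiplying 1 + w <= exp w by the hypothesis gives (1 + w)(1 - q) <= 1, that is w (1 -
  q) <= q, and 1 - q >= 1/2.\<close>

lemma one_minus_le_exp_minus_imp:
  fixes q w :: real
  assumes "q \<le> 1 / 2" "0 \<le> w" "1 - q \<le> exp (- w)"
  shows "w \<le> 2 * q"
proof -
  have "(1 + w) * (1 - q) \<le> exp w * exp (- w)"
    using assms exp_ge_add_one_self[of w] by (intro mult_mono) auto
  then have "w * (1 - q) \<le> q" by (simp add: exp_minus field_simps)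
  moreover have "w * (1 / 2) \<le> w * (1 - q)" using assms by (intro mult_left_mono) auto
  ultimately show ?thesis by simp
qed

locale levy_khintchine = N: real_distribution N
  for N :: "real measure" +
  fixes \<nu> :: "real measure" and a b V :: real
  assumes a_nonneg: "0 \<le> a" and sets_\<nu>[measurable_cong]: "sets \<nu> = sets borel"
    and levy_finite: "(\<integral>\<^sup>+ x. ennreal (min 1 (x\<^sup>2)) \<partial>\<nu>) < \<infinity>"
    and char_N: "char N u = exp (\<i> * of_real (b * u) - of_real (a * u\<^sup>2 / 2) +
          (CLINT x|\<nu>. exp (\<i> * of_real (u * x)) - 1 - \<i> * of_real (u * x) * indicator {-1..1} x))"
    and square_integrable_N: "integrable N (\<lambda>x. x\<^sup>2)"
    and mean_N: "(\<integral>x. x \<partial>N) = 0" and second_moment_N: "V = (\<integral>x. x\<^sup>2 \<partial>N)" and V_pos: "0 < V"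
begin

abbreviation levy_integrand :: "real \<Rightarrow> real \<Rightarrow> complex" where
  "levy_integrand u x \<equiv> exp (\<i> * of_real (u * x)) - 1 - \<i> * of_real (u * x) * indicator {-1..1} x"

lemma integrable_levy_integrand: "integrable \<nu> (levy_integrand u)"
proof (rule Bochner_Integration.integrable_bound)
  show "integrable \<nu> (\<lambda>x. (2 + u\<^sup>2) * min 1 (x\<^sup>2))"
    using levy_finite by (intro integrable_mult_right integrableI_nonneg) auto
  show "AE x in \<nu>. norm (levy_integrand u x) \<le> norm ((2 + u\<^sup>2) * min 1 (x\<^sup>2))"
    using iexp_diff_bound[of u] by (auto intro!: AE_I2 simp: abs_mult order_trans[OF _ abs_ge_self])
qed measurable

lemma square_dominates: "\<bar>x\<bar> \<le> 1 + x\<^sup>2" for x :: real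
  using zero_le_power2[of "\<bar>x\<bar> - 1"] by (simp add: power2_diff)

lemma integrable_N: "integrable N (\<lambda>x. x)"
proof (rule Bochner_Integration.integrable_bound)
  show "integrable N (\<lambda>x. 1 + x\<^sup>2)" using square_integrable_N by simp
  show "AE x in N. norm x \<le> norm (1 + x\<^sup>2)" using square_dominates by (auto simp: abs_of_nonneg)
qed simp

text \<open>The modulus of the characteristic function is at most the exponential of minus the
  integral of 1 - cos (u x). The finite variance bounds it below by 1 - u^2 V / 2. Comparing the two
  controls the Levy measure by the variance of X.\<close>

lemma cos_exponent_bound:
  assumes "u\<^sup>2 * V \<le> 1"
  shows "integrable \<nu> (\<lambda>x. 1 - cos (u * x))" "(\<integral>x. 1 - cos (u * x) \<partial>\<nu>) \<le> u\<^sup>2 * V"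
proof -
  have Re_integrand: "1 - cos (u * x) = - Re (levy_integrand u x)" for x
    by (simp add: Re_exp indicator_def)
  show int: "integrable \<nu> (\<lambda>x. 1 - cos (u * x))"
    unfolding Re_integrand using integrable_levy_integrand[of u] by (intro integrable_minus integrable_Re)
  let ?W = "\<integral>x. 1 - cos (u * x) \<partial>\<nu>"
  have W: "0 \<le> ?W" by (intro integral_nonneg_AE) auto
  have "?W = (\<integral>x. - Re (levy_integrand u x) \<partial>\<nu>)"
    by (rule Bochner_Integration.integral_cong[OF refl Re_integrand])
  then have "(\<integral>x. Re (levy_integrand u x) \<partial>\<nu>) = - ?W"
    by (simp only: Bochner_Integration.integral_minus minus_minus)
  then have "Re (CLINT x|\<nu>. levy_integrand u x) = - ?W"
    using integral_Re[OF integrable_levy_integrand[of u]] by simp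
  then have norm: "cmod (char N u) = exp (- (a * u\<^sup>2 / 2) - ?W)"
    unfolding char_N norm_exp_eq_Re by simp
  \<comment> \<open>The lower bound integrates 1 - z^2 / 2 <= cos z at z = u x, and the real part is
    at most the modulus.\<close>
  have "1 - u\<^sup>2 * V / 2 = (\<integral>x. 1 - u\<^sup>2 / 2 * x\<^sup>2 \<partial>N)"
    using square_integrable_N N.prob_space by (simp add: second_moment_N)
  also have "\<dots> \<le> (\<integral>x. cos (u * x) \<partial>N)"
  proof (rule integral_mono)
    show "integrable N (\<lambda>x. cos (u * x))" by (rule N.integrable_const_bound[where B=1]) auto
    show "1 - u\<^sup>2 / 2 * x\<^sup>2 \<le> cos (u * x)" for x
    proof -
      have "(sin (u * x / 2))\<^sup>2 \<le> (u * x / 2)\<^sup>2" using abs_sin_x_le_abs_x[of "u * x / 2"] by (metis abs_le_square_iff)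
      then show ?thesis using cos_double_sin[of "u * x / 2"] by (simp add: power_mult_distrib power_divide field_simps)
    qed
  qed (use square_integrable_N in simp)
  also have "\<dots> = Re (char N u)"
    unfolding char_def using integral_Re[OF N.integrable_iexp[of "\<lambda>x. u * x"]] by (simp add: Re_exp)
  also have "\<dots> \<le> cmod (char N u)" by (rule complex_Re_le_cmod)
  also have "\<dots> \<le> exp (- ?W)" unfolding norm using a_nonneg by simp
  finally show "?W \<le> u\<^sup>2 * V" using one_minus_le_exp_minus_imp[of "u\<^sup>2 * V / 2" ?W] W assms by simp
qed

text \<open>With u = 1/n, the bound u^2 V becomes V after multiplication by n^2, uniformly in n;
  Fatou's lemma then bounds the integral of x^2 / 2.\<close>

lemma square_integrable_\<nu>: "integrable \<nu> (\<lambda>x. x\<^sup>2)"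
proof -
  let ?f = "\<lambda>n x. ennreal ((1 - cos (x / real n)) * (real n)\<^sup>2)"
  have "(\<integral>\<^sup>+x. ennreal (x\<^sup>2 / 2) \<partial>\<nu>) = (\<integral>\<^sup>+x. liminf (\<lambda>n. ?f n x) \<partial>\<nu>)"
  proof (intro nn_integral_cong)
    fix x
    have "(\<lambda>n. ?f n x) \<longlonglongrightarrow> ennreal (x\<^sup>2 / 2)"
      by (intro tendsto_ennrealI one_minus_cos_scaled_tendsto)
    from lim_imp_Liminf[OF trivial_limit_sequentially this]
    show "ennreal (x\<^sup>2 / 2) = liminf (\<lambda>n. ?f n x)" by (rule sym)
  qed
  also have "\<dots> \<le> liminf (\<lambda>n. \<integral>\<^sup>+x. ?f n x \<partial>\<nu>)"
    by (intro nn_integral_liminf) measurable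
  also have "\<dots> \<le> ennreal V"
  proof -
    have "\<forall>\<^sub>F n in sequentially. (\<integral>\<^sup>+x. ?f n x \<partial>\<nu>) \<le> ennreal V"
      \<comment> \<open>This threshold gives n >= 1 and V <= n <= n^2, so that u = 1/n satisfies u^2
        V <= 1.\<close>
      using eventually_ge_at_top[of "nat \<lceil>V\<rceil> + 1"]
    proof eventually_elim
      case (elim n)
      then have n: "1 \<le> real n" "V \<le> real n" by linarith+
      have "V \<le> (real n)\<^sup>2" using n mult_mono[of 1 "real n" V "real n"] V_pos by (simp add: power2_eq_square)
      then have u: "(1 / real n)\<^sup>2 * V \<le> 1" using n by (simp add: power_divide field_simps)
      note cos = cos_exponent_bound[OF u]
      have "(\<integral>\<^sup>+x. ?f n x \<partial>\<nu>) = ennreal (\<integral>x. (1 - cos (1 / real n * x)) * (real n)\<^sup>2 \<partial>\<nu>)"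
        using cos(1) by (subst nn_integral_eq_integral[symmetric]) auto
      also have "(\<integral>x. (1 - cos (1 / real n * x)) * (real n)\<^sup>2 \<partial>\<nu>) = (\<integral>x. 1 - cos (1 / real n * x) \<partial>\<nu>) * (real n)\<^sup>2"
        using cos(1) by simp
      also have "\<dots> \<le> (1 / real n)\<^sup>2 * V * (real n)\<^sup>2"
        by (intro mult_right_mono cos(2)) simp
      also have "\<dots> = V" using n by (simp add: power_divide)
      finally show ?case by (simp add: ennreal_leI)
    qed
    then show ?thesis by (rule Liminf_le[OF trivial_limit_sequentially])
  qed
  finally have "(\<integral>\<^sup>+x. ennreal (x\<^sup>2 / 2) \<partial>\<nu>) < \<infinity>" by (simp add: order_le_less_trans)
  then have "integrable \<nu> (\<lambda>x. x\<^sup>2 / 2)" by (intro integrableI_nonneg) auto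
  from integrable_mult_right[OF this, of 2] show ?thesis by simp
qed

section \<open>Differentiating the Levy--Khintchine formula\<close>

lemma char_has_derivative: "(char N has_vector_derivative (\<integral>x. \<i> * of_real x * iexp (u * x) \<partial>N)) (at u)"
proof -
  have "((\<lambda>s. CLINT x|N. iexp (s * x)) has_vector_derivative (\<integral>x. \<i> * of_real x * iexp (u * x) \<partial>N)) (at u)"
  proof (rule has_vector_derivative_integral[where d=1 and g="\<lambda>x. \<bar>x\<bar>"])
    show "((\<lambda>s. iexp (s * x)) has_vector_derivative \<i> * of_real x * iexp (s * x)) (at s)" for s x
    proof -
      have "((\<lambda>w. exp (\<i> * (w * of_real x))) has_field_derivative exp (\<i> * (of_real s * of_real x)) * (\<i> * of_real x)) (at (of_real s))"
        by (auto intro!: derivative_eq_intros)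
      from has_vector_derivative_real_field[OF this] show ?thesis by (simp add: mult_ac)
    qed
    show "integrable N (\<lambda>x. iexp (s * x))" for s using N.integrable_iexp[of "\<lambda>x. s * x"] by simp
  qed (use integrable_N in \<open>auto simp: norm_mult\<close>)
  then show ?thesis unfolding char_def[abs_def] .
qed

text \<open>Inside [-1, 1] the compensator makes the derivative of the Levy integrand second order
  in x; outside, \<bar>x\<bar> <= x^2. Hence the square integrability of \<nu> suffices for
  domination.\<close>

lemma drift_bound: "norm (\<i> * of_real x * (iexp (u * x) - indicator {-1..1} x)) \<le> (\<bar>u\<bar> + 1) * x\<^sup>2"
proof (cases "x \<in> {-1..1}")
  case True
  have "cmod (iexp (u * x) - 1) \<le> \<bar>u * x\<bar>" using iexp_approx1[of "u * x" 0] by simp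
  also have "\<dots> \<le> (\<bar>u\<bar> + 1) * \<bar>x\<bar>" by (simp add: abs_mult mult_right_mono)
  finally have "\<bar>x\<bar> * cmod (iexp (u * x) - 1) \<le> \<bar>x\<bar> * ((\<bar>u\<bar> + 1) * \<bar>x\<bar>)" by (intro mult_left_mono) auto
  also have "\<dots> = (\<bar>u\<bar> + 1) * x\<^sup>2" by (simp add: power2_eq_square mult_ac flip: abs_mult)
  finally show ?thesis using True by (simp add: norm_mult)
next
  case False
  then have "1 \<le> \<bar>x\<bar>" by auto
  then have "\<bar>x\<bar> * 1 \<le> \<bar>x\<bar> * \<bar>x\<bar>" by (intro mult_left_mono) auto
  then have "\<bar>x\<bar> \<le> x\<^sup>2" by (simp add: power2_eq_square flip: abs_mult)
  also have "\<dots> \<le> (\<bar>u\<bar> + 1) * x\<^sup>2" by (simp add: distrib_right)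
  finally show ?thesis using False by (simp add: norm_mult)
qed

lemma exponent_has_derivative:
  "((\<lambda>u. CLINT x|\<nu>. levy_integrand u x) has_vector_derivative
     (\<integral>x. \<i> * of_real x * (iexp (u * x) - indicator {-1..1} x) \<partial>\<nu>)) (at u)"
proof (rule has_vector_derivative_integral[where d=1 and g="\<lambda>x. (\<bar>u\<bar> + 3) * x\<^sup>2"])
  show "((\<lambda>s. levy_integrand s x) has_vector_derivative \<i> * of_real x * (iexp (s * x) - indicator {-1..1} x)) (at s)" for s x
  proof -
    have "((\<lambda>w. exp (\<i> * (w * of_real x)) - 1 - \<i> * (w * of_real x) * indicator {-1..1} x) has_field_derivative
      exp (\<i> * (of_real s * of_real x)) * (\<i> * of_real x) - \<i> * of_real x * indicator {-1..1} x) (at (of_real s))"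
      by (auto intro!: derivative_eq_intros)
    from has_vector_derivative_real_field[OF this] show ?thesis by (simp add: algebra_simps)
  qed
  show "norm (\<i> * of_real x * (iexp (s * x) - indicator {-1..1} x)) \<le> (\<bar>u\<bar> + 3) * x\<^sup>2" if "s \<in> ball u 1" for s x
  proof -
    have "(\<bar>s\<bar> + 1) * x\<^sup>2 \<le> (\<bar>u\<bar> + 3) * x\<^sup>2"
      using that by (intro mult_right_mono) (auto simp: dist_real_def)
    with drift_bound[of x s] show ?thesis by linarith
  qed
qed (use square_integrable_\<nu> integrable_levy_integrand in auto)

lemma integrable_drift: "integrable \<nu> (\<lambda>x. \<i> * of_real x * (iexp (u * x) - indicator {-1..1} x))"
proof (rule Bochner_Integration.integrable_bound)
  show "integrable \<nu> (\<lambda>x. (\<bar>u\<bar> + 1) * x\<^sup>2)" using square_integrable_\<nu> by simp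
  show "AE x in \<nu>. norm (\<i> * of_real x * (iexp (u * x) - indicator {-1..1} x)) \<le> norm ((\<bar>u\<bar> + 1) * x\<^sup>2)"
    using drift_bound[of _ u] by (auto intro!: AE_I2 simp: abs_mult)
qed measurable

text \<open>This identity creates both ingredients of the zero-bias law, the weight x^2 and the
  uniform factor. It is integrated against \<open>N\<close> and against \<nu>.\<close>

lemma mult_iexp_minus_one: "\<i> * of_real x * (iexp (u * x) - 1) = - of_real u * (x\<^sup>2 *\<^sub>R char unit_uniform (u * x))"
  unfolding char_unit_uniform[symmetric] by (simp add: scaleR_conv_of_real power2_eq_square mult_ac)

text \<open>Up to the factor V this is the zero-bias identity for characteristic functions. It is
  the equation for the derivative of exp (\<Psi>), divided by -u after the drift has been eliminated
  through the mean zero.\<close>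

lemma char_identity:
  assumes u: "u \<noteq> 0"
  shows "(\<integral>x. x\<^sup>2 *\<^sub>R char unit_uniform (u * x) \<partial>N) =
    char N u * (of_real a + (\<integral>x. x\<^sup>2 *\<^sub>R char unit_uniform (u * x) \<partial>\<nu>))"
proof -
  define \<Psi> where "\<Psi> u = \<i> * of_real (b * u) - of_real (a * u\<^sup>2 / 2) + (CLINT x|\<nu>. levy_integrand u x)" for u
  define D where "D u = \<i> * of_real b - of_real (a * u) +
    (\<integral>x. \<i> * of_real x * (iexp (u * x) - indicator {-1..1} x) \<partial>\<nu>)" for u
  have \<Psi>: "(\<Psi> has_vector_derivative D s) (at s)" for s
  proof -
    have "((\<lambda>w. \<i> * (of_real b * w) - of_real a * w\<^sup>2 / 2) has_field_derivative \<i> * of_real b - of_real a * of_real s) (at (of_real s))"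
      by (auto intro!: derivative_eq_intros)
    from has_vector_derivative_add[OF has_vector_derivative_real_field[OF this] exponent_has_derivative]
    show ?thesis unfolding \<Psi>_def[abs_def] D_def by simp
  qed
  have "char N = exp \<circ> \<Psi>" unfolding \<Psi>_def char_N[abs_def] by (simp add: comp_def)
  moreover have "((exp \<circ> \<Psi>) has_vector_derivative D s * exp (\<Psi> s)) (at s)" for s
    by (rule field_vector_diff_chain_at[OF \<Psi>]) (rule DERIV_exp)
  ultimately have eq: "(\<integral>x. \<i> * of_real x * iexp (s * x) \<partial>N) = D s * char N s" for s
    using vector_derivative_unique_at[OF char_has_derivative[of s]] by (metis comp_apply)
  have mean: "(\<integral>x. \<i> * of_real x \<partial>N) = 0"
    using mean_N integrable_N by simp
  \<comment> \<open>Centering makes the derivative of the characteristic function vanish at 0.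
    Subtracting D(0) therefore changes nothing, but it cancels the drift \<open>b\<close> and the
    compensator.\<close>
  have "D 0 = 0" using eq[of 0] mean N.char_zero by simp
  have "(\<integral>x. \<i> * of_real x * (iexp (u * x) - indicator {-1..1} x) \<partial>\<nu>) -
      (\<integral>x. \<i> * of_real x * (iexp (0 * x) - indicator {-1..1} x) \<partial>\<nu>) =
      (\<integral>x. \<i> * of_real x * (iexp (u * x) - indicator {-1..1} x) - \<i> * of_real x * (iexp (0 * x) - indicator {-1..1} x) \<partial>\<nu>)"
    by (rule Bochner_Integration.integral_diff[symmetric]; rule integrable_drift)
  also have "\<dots> = (\<integral>x. - of_real u * (x\<^sup>2 *\<^sub>R char unit_uniform (u * x)) \<partial>\<nu>)"
    unfolding mult_iexp_minus_one[symmetric] by (intro Bochner_Integration.integral_cong refl) (simp add: right_diff_distrib)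
  also have "\<dots> = - of_real u * (\<integral>x. x\<^sup>2 *\<^sub>R char unit_uniform (u * x) \<partial>\<nu>)"
    by (rule integral_mult_right_zero)
  finally have "D u - D 0 = - of_real u * (of_real a + (\<integral>x. x\<^sup>2 *\<^sub>R char unit_uniform (u * x) \<partial>\<nu>))"
    unfolding D_def by (simp add: algebra_simps)
  then have Du: "D u = - of_real u * (of_real a + (\<integral>x. x\<^sup>2 *\<^sub>R char unit_uniform (u * x) \<partial>\<nu>))"
    using \<open>D 0 = 0\<close> by simp
  have i: "integrable N (\<lambda>x. \<i> * of_real x * iexp (u * x))"
    by (rule Bochner_Integration.integrable_bound[OF integrable_N]) (auto simp: norm_mult)
  have "- of_real u * (\<integral>x. x\<^sup>2 *\<^sub>R char unit_uniform (u * x) \<partial>N) = (\<integral>x. \<i> * of_real x * (iexp (u * x) - 1) \<partial>N)"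
    unfolding mult_iexp_minus_one by (rule integral_mult_right_zero[symmetric])
  also have "\<dots> = (\<integral>x. \<i> * of_real x * iexp (u * x) - \<i> * of_real x \<partial>N)"
    by (intro Bochner_Integration.integral_cong refl) (simp add: right_diff_distrib)
  also have "\<dots> = (\<integral>x. \<i> * of_real x * iexp (u * x) \<partial>N)"
    using i integrable_N mean by (subst Bochner_Integration.integral_diff) auto
  also have "\<dots> = - of_real u * (char N u * (of_real a + (\<integral>x. x\<^sup>2 *\<^sub>R char unit_uniform (u * x) \<partial>\<nu>)))"
    unfolding eq Du by (simp add: mult_ac)
  finally show ?thesis using u by simp
qed

text \<open>The limit of \<open>char_identity\<close> as u tends to 0 along 1/(n+1); all
  characteristic functions involved tend to 1, with x^2 as dominating function. It identifies the
  normalizing mass of the canonical law with the variance of X.\<close>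

lemma variance_eq: "V = a + (\<integral>x. x\<^sup>2 \<partial>\<nu>)"
proof -
  have lim: "(\<lambda>n. \<integral>x. x\<^sup>2 *\<^sub>R char unit_uniform (inverse (real (Suc n)) * x) \<partial>Q) \<longlonglongrightarrow> of_real (\<integral>x. x\<^sup>2 \<partial>Q)"
    if Q: "sets Q = sets borel" "integrable Q (\<lambda>x. x\<^sup>2)" for Q :: "real measure"
  proof -
    note [measurable_cong] = Q(1)
    have "(\<lambda>n. \<integral>x. x\<^sup>2 *\<^sub>R char unit_uniform (inverse (real (Suc n)) * x) \<partial>Q) \<longlonglongrightarrow> (\<integral>x. of_real (x\<^sup>2) \<partial>Q)"
    proof (rule integral_dominated_convergence[where w="\<lambda>x. x\<^sup>2"])
      show "AE x in Q. (\<lambda>n. x\<^sup>2 *\<^sub>R char unit_uniform (inverse (real (Suc n)) * x)) \<longlonglongrightarrow> of_real (x\<^sup>2)"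
      proof (rule AE_I2)
        fix x
        have "(\<lambda>n. inverse (real (Suc n)) * x) \<longlonglongrightarrow> 0 * x"
          by (intro tendsto_intros LIMSEQ_inverse_real_of_nat)
        then have "(\<lambda>n. char unit_uniform (inverse (real (Suc n)) * x)) \<longlonglongrightarrow> char unit_uniform 0"
          by (intro isCont_tendsto_compose[OF unit_uniform.isCont_char]) simp
        then have "(\<lambda>n. x\<^sup>2 *\<^sub>R char unit_uniform (inverse (real (Suc n)) * x)) \<longlonglongrightarrow> x\<^sup>2 *\<^sub>R 1"
          unfolding unit_uniform.char_zero by (intro tendsto_intros)
        then show "(\<lambda>n. x\<^sup>2 *\<^sub>R char unit_uniform (inverse (real (Suc n)) * x)) \<longlonglongrightarrow> of_real (x\<^sup>2)"
          by (simp add: scaleR_conv_of_real)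
      qed
      show "AE x in Q. norm (x\<^sup>2 *\<^sub>R char unit_uniform (inverse (real (Suc n)) * x)) \<le> x\<^sup>2" for n
        using unit_uniform.cmod_char_le_1 by (auto simp: mult_left_le)
    qed (use Q(2) in measurable)
    then show ?thesis unfolding integral_complex_of_real .
  qed
  have sN: "sets N = sets borel" by simp
  have "(\<lambda>n. char N (inverse (real (Suc n)))) \<longlonglongrightarrow> char N 0"
    by (intro isCont_tendsto_compose[OF N.isCont_char] LIMSEQ_inverse_real_of_nat)
  then have "(\<lambda>n. char N (inverse (real (Suc n))) * (of_real a + (\<integral>x. x\<^sup>2 *\<^sub>R char unit_uniform (inverse (real (Suc n)) * x) \<partial>\<nu>)))
    \<longlonglongrightarrow> 1 * (of_real a + of_real (\<integral>x. x\<^sup>2 \<partial>\<nu>))"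
    unfolding N.char_zero by (intro tendsto_intros lim sets_\<nu> square_integrable_\<nu>)
  moreover have "(\<lambda>n. char N (inverse (real (Suc n))) * (of_real a + (\<integral>x. x\<^sup>2 *\<^sub>R char unit_uniform (inverse (real (Suc n)) * x) \<partial>\<nu>)))
    \<longlonglongrightarrow> of_real (\<integral>x. x\<^sup>2 \<partial>N)"
    using lim[OF sN square_integrable_N] char_identity[of "inverse (real (Suc n))" for n] by simp
  ultimately have "of_real (\<integral>x. x\<^sup>2 \<partial>N) = 1 * (of_real a + of_real (\<integral>x. x\<^sup>2 \<partial>\<nu>) :: complex)"
    by (rule LIMSEQ_unique[rotated])
  then show ?thesis unfolding second_moment_N by (simp flip: of_real_add)
qed

sublocale finite_levy_moment a \<nu> V
  using a_nonneg sets_\<nu> square_integrable_\<nu> variance_eq V_pos by unfold_locales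

section \<open>The zero-bias identity as an equality of laws\<close>

definition square_biased :: "real measure" where
  "square_biased = density N (\<lambda>x. ennreal (x\<^sup>2 / V))"

lemma real_distribution_square_biased: "real_distribution square_biased"
proof -
  have "emeasure square_biased (space square_biased) = (\<integral>\<^sup>+x. ennreal (x\<^sup>2 / V) \<partial>N)"
    unfolding square_biased_def by (subst emeasure_density) auto
  also have "\<dots> = ennreal (\<integral>x. x\<^sup>2 / V \<partial>N)"
    using square_integrable_N V_pos by (intro nn_integral_eq_integral) auto
  also have "(\<integral>x. x\<^sup>2 / V \<partial>N) = (\<integral>x. x\<^sup>2 \<partial>N) / V" by (rule integral_divide_zero)
  also have "\<dots> = 1" using V_pos second_moment_N by simp
  also have "ennreal 1 = 1" by simp
  finally have "prob_space square_biased" by (rule prob_spaceI)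
  then show ?thesis
    unfolding real_distribution_def real_distribution_axioms_def by (simp add: square_biased_def)
qed

lemma real_distribution_canonical_law: "real_distribution (canonical_law a \<nu>)"
  unfolding real_distribution_def real_distribution_axioms_def
  using prob_space_canonical_law sets_canonical_law by simp

text \<open>\<open>char_identity\<close> divided by V says that the characteristic functions agree,
  and Levy's uniqueness theorem lifts this to the laws. The point u = 0, where that identity was
  divided by u, holds because both sides are probability laws.\<close>

theorem zero_bias_law:
  "uniform_scaling square_biased = distr (N \<Otimes>\<^sub>M uniform_scaling (canonical_law a \<nu>)) borel (\<lambda>(x, y). x + y)"
    (is "?A = ?B")
proof (rule Levy_uniqueness)
  note us = real_distribution_uniform_scaling[OF real_distribution_canonical_law]
  have rN: "real_distribution N" by (rule N.real_distribution_axioms)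
  show A: "real_distribution ?A" by (rule real_distribution_uniform_scaling[OF real_distribution_square_biased])
  show B: "real_distribution ?B" by (rule real_distribution_sum[OF rN us])
  show "char ?A = char ?B"
  proof
    fix u
    show "char ?A u = char ?B u"
    proof (cases "u = 0")
      case True
      then show ?thesis by (simp add: real_distribution.char_zero[OF A] real_distribution.char_zero[OF B])
    next
      case False
      have "V * char ?A u = V * (\<integral>x. (x\<^sup>2 / V) *\<^sub>R char unit_uniform (u * x) \<partial>N)"
        unfolding char_uniform_scaling[OF real_distribution_square_biased] unfolding square_biased_def
        using V_pos by (subst integral_density) auto
      also have "\<dots> = (\<integral>x. V * ((x\<^sup>2 / V) *\<^sub>R char unit_uniform (u * x)) \<partial>N)"
        by (rule integral_mult_right_zero[symmetric])
      also have "\<dots> = (\<integral>x. x\<^sup>2 *\<^sub>R char unit_uniform (u * x) \<partial>N)"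
        using V_pos by (intro Bochner_Integration.integral_cong) (auto simp: scaleR_conv_of_real)
      also have "\<dots> = char N u * (of_real a + (\<integral>x. x\<^sup>2 *\<^sub>R char unit_uniform (u * x) \<partial>\<nu>))"
        by (rule char_identity[OF False])
      also have "of_real a + (\<integral>x. x\<^sup>2 *\<^sub>R char unit_uniform (u * x) \<partial>\<nu>) = V * (\<integral>x. char unit_uniform (u * x) \<partial>canonical_law a \<nu>)"
        using unit_uniform.cmod_char_le_1 unit_uniform.char_zero
        by (subst integral_canonical_law[of _ 1]) auto
      also have "char N u * (V * (\<integral>x. char unit_uniform (u * x) \<partial>canonical_law a \<nu>)) = V * char ?B u"
        unfolding char_sum[OF rN us] char_uniform_scaling[OF real_distribution_canonical_law] by (simp add: mult_ac)
      finally show ?thesis using V_pos by simp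
    qed
  qed
qed

text \<open>Passing from characteristic functions to laws is what makes unbounded test functions
  such as real exponentials admissible.\<close>

theorem biased:
  assumes [measurable]: "f \<in> borel_measurable borel"
  shows "(\<integral>\<^sup>+x. ennreal (x\<^sup>2) * (\<integral>\<^sup>+u\<in>{0..1}. f (u * x) \<partial>lborel) \<partial>N) =
     ennreal V * (\<integral>\<^sup>+x. \<integral>\<^sup>+y. (\<integral>\<^sup>+u\<in>{0..1}. f (x + u * y) \<partial>lborel) \<partial>canonical_law a \<nu> \<partial>N)"
proof -
  have "(\<integral>\<^sup>+x. ennreal (x\<^sup>2) * (\<integral>\<^sup>+u\<in>{0..1}. f (u * x) \<partial>lborel) \<partial>N) =
    (\<integral>\<^sup>+x. ennreal V * (ennreal (x\<^sup>2 / V) * (\<integral>\<^sup>+u\<in>{0..1}. f (u * x) \<partial>lborel)) \<partial>N)"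
    using V_pos by (intro nn_integral_cong) (simp add: mult.assoc[symmetric] ennreal_mult'[symmetric])
  also have "\<dots> = ennreal V * (\<integral>\<^sup>+x. ennreal (x\<^sup>2 / V) * (\<integral>\<^sup>+u\<in>{0..1}. f (u * x) \<partial>lborel) \<partial>N)"
    by (rule nn_integral_cmult) measurable
  also have "(\<integral>\<^sup>+x. ennreal (x\<^sup>2 / V) * (\<integral>\<^sup>+u\<in>{0..1}. f (u * x) \<partial>lborel) \<partial>N) = (\<integral>\<^sup>+x. f x \<partial>uniform_scaling square_biased)"
    unfolding nn_integral_uniform_scaling[OF real_distribution_square_biased assms] unfolding square_biased_def
    by (rule nn_integral_density[symmetric]) measurable
  also have "\<dots> = (\<integral>\<^sup>+x. \<integral>\<^sup>+y. (\<integral>\<^sup>+u\<in>{0..1}. f (x + u * y) \<partial>lborel) \<partial>canonical_law a \<nu> \<partial>N)"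
    unfolding zero_bias_law
      nn_integral_sum[OF N.real_distribution_axioms real_distribution_uniform_scaling[OF real_distribution_canonical_law] assms]
    by (intro nn_integral_cong nn_integral_uniform_scaling[OF real_distribution_canonical_law]) measurable
  finally show ?thesis .
qed

sublocale zero_bias N "canonical_law a \<nu>" V
  by unfold_locales (use N.prob_space_axioms prob_space_canonical_law sets_canonical_law V_pos integrable_N mean_N biased in auto)

end

section \<open>Scales and the canonical remainder\<close>

lemma less_one_divide_ereal_iff:
  assumes "0 \<le> c" "0 \<le> t"
  shows "ereal t < 1 / ereal c \<longleftrightarrow> c * t < 1"
proof (cases "c = 0")
  case False
  then have "1 / ereal c = ereal (1 / c)" by (simp add: one_ereal_def)
  then show ?thesis using False assms by (simp add: field_simps)
qed (simp add: divide_ereal_def)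

lemma tau_plus_pos_iff: "0 < tau_plus M X \<longleftrightarrow> (\<exists>t>0. cumulant M X t < \<infinity>)"
proof
  assume "0 < tau_plus M X"
  then show "\<exists>t>0. cumulant M X t < \<infinity>" by (auto simp: tau_plus_def Let_def split: if_splits)
next
  assume "\<exists>t>0. cumulant M X t < \<infinity>"
  then obtain t where t: "0 < t" "cumulant M X t < \<infinity>" by blast
  have "0 < ereal t" using t by simp
  also have "ereal t \<le> Sup (ereal ` {t. 0 < t \<and> cumulant M X t < \<infinity>})"
    using t by (intro Sup_upper) auto
  finally show "0 < tau_plus M X" using t by (auto simp: tau_plus_def Let_def)
qed

text \<open>The variable \<open>g\<close> on \<open>R\<close> is kept abstract so that one remainder
  law serves both tails: \<open>g\<close> is the identity for X and the negation for -X. Finite and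
  infinite moments are covered by one formula.\<close>

locale remainder_formula =
  fixes M :: "'a measure" and X :: "'a \<Rightarrow> real" and R :: "'b measure" and g :: "'b \<Rightarrow> real" and V :: real
  assumes prob_M: "prob_space M" and prob_R: "prob_space R"
    and g_measurable[measurable]: "g \<in> borel_measurable R"
    and V_pos: "0 < V" and variance: "prob_space.variance M X = V"
    and formula: "0 \<le> t \<Longrightarrow> (\<integral>\<^sup>+\<omega>. ennreal (exp (t * X \<omega>)) \<partial>M) =
      (let K = ennreal (V * t\<^sup>2 / 2) * (\<integral>\<^sup>+r. ennreal (exp (t * g r)) \<partial>R)
       in if K = \<infinity> then \<infinity> else ennreal (exp (enn2real K)))"
begin

sublocale R: prob_space R by (rule prob_R)

definition Psi :: "real \<Rightarrow> ereal" where
  "Psi t = (1 - 1 / mgf R g t) / ereal t"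

text \<open>The moment generating function is never 0, as the exponential is positive and
  \<open>R\<close> is a probability measure. So its reciprocal in \<open>Psi\<close> is either 0 or
  that of a positive real.\<close>

lemma mgf_cases:
  obtains (infinite) "mgf R g t = \<infinity>" "(\<integral>\<^sup>+r. ennreal (exp (t * g r)) \<partial>R) = \<infinity>"
    | (finite) m where "0 < m" "mgf R g t = ereal m" "(\<integral>\<^sup>+r. ennreal (exp (t * g r)) \<partial>R) = ennreal m"
proof (cases "(\<integral>\<^sup>+r. ennreal (exp (t * g r)) \<partial>R)" rule: ennreal_cases)
  case (real m)
  have "m \<noteq> 0"
  proof
    assume "m = 0"
    then have "AE r in R. ennreal (exp (t * g r)) = 0"
      using real by (intro nn_integral_0_iff_AE[THEN iffD1]) auto
    then show False using R.AE_False by simp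
  qed
  then show ?thesis using real finite[of m] by (auto simp: mgf_def)
next
  case top
  then show ?thesis using infinite by (auto simp: mgf_def)
qed

lemma cumulant_eq:
  assumes "0 \<le> t"
  shows "cumulant M X t = enn2ereal (ennreal (V * t\<^sup>2 / 2) * (\<integral>\<^sup>+r. ennreal (exp (t * g r)) \<partial>R))"
proof (cases "ennreal (V * t\<^sup>2 / 2) * (\<integral>\<^sup>+r. ennreal (exp (t * g r)) \<partial>R)" rule: ennreal_cases)
  case (real k)
  then have "(\<integral>\<^sup>+\<omega>. ennreal (exp (t * X \<omega>)) \<partial>M) = ennreal (exp k)"
    using formula[OF assms] by (simp add: Let_def)
  then show ?thesis unfolding real(2) using real(1) by (simp add: cumulant_def mgf_def)
next
  case top
  then show ?thesis using formula[OF assms] by (simp add: cumulant_def mgf_def Let_def)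
qed

lemma cumulant_finite_iff:
  assumes "0 < t"
  shows "cumulant M X t < \<infinity> \<longleftrightarrow> mgf R g t < \<infinity>"
  using assms V_pos
  by (cases t rule: mgf_cases) (auto simp: cumulant_eq ennreal_mult_top ennreal_mult'[symmetric])

text \<open>For c t < 1 and a finite moment m, cancelling V t^2 / 2 leaves m (1 - c t) <= 1, which
  rearranges to (1 - 1/m) / t <= c. For an infinite moment both sides say c t >= 1.\<close>

lemma cumulant_le_iff_Psi_le:
  assumes t: "0 < t" and c: "0 \<le> c"
  shows "(c * t < 1 \<longrightarrow> cumulant M X t \<le> ereal (V * t\<^sup>2 / (2 * (1 - c * t)))) \<longleftrightarrow> Psi t \<le> ereal c"
proof (cases t rule: mgf_cases)
  case infinite
  have "cumulant M X t = \<infinity>" using infinite t V_pos by (simp add: cumulant_eq ennreal_mult_top)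
  moreover have "Psi t = ereal (1 / t)" using infinite t by (simp add: Psi_def one_ereal_def)
  ultimately show ?thesis using t by (auto simp: field_simps)
next
  case (finite m)
  have K: "cumulant M X t = ereal (V * t\<^sup>2 / 2 * m)"
    using finite t V_pos by (simp add: cumulant_eq ennreal_mult'[symmetric])
  have "1 / ereal m = ereal (1 / m)" using finite by (simp add: one_ereal_def)
  then have P: "Psi t = ereal ((1 - 1 / m) / t)" using finite t by (simp add: Psi_def one_ereal_def)
  have "(c * t < 1 \<longrightarrow> V * t\<^sup>2 / 2 * m \<le> V * t\<^sup>2 / (2 * (1 - c * t))) \<longleftrightarrow> (c * t < 1 \<longrightarrow> m * (1 - c * t) \<le> 1)"
  proof (intro imp_cong refl)
    assume ct: "c * t < 1"
    have "V * t\<^sup>2 / 2 * m \<le> V * t\<^sup>2 / (2 * (1 - c * t)) \<longleftrightarrow> (V * t\<^sup>2 / 2) * m \<le> (V * t\<^sup>2 / 2) * (1 / (1 - c * t))"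
      by simp
    also have "\<dots> \<longleftrightarrow> m \<le> 1 / (1 - c * t)" using t V_pos by (subst mult_le_cancel_left_pos) auto
    also have "\<dots> \<longleftrightarrow> m * (1 - c * t) \<le> 1" using ct by (simp add: pos_le_divide_eq)
    finally show "V * t\<^sup>2 / 2 * m \<le> V * t\<^sup>2 / (2 * (1 - c * t)) \<longleftrightarrow> m * (1 - c * t) \<le> 1" .
  qed
  also have "\<dots> \<longleftrightarrow> m * (1 - c * t) \<le> 1"
  proof -
    have "m * (1 - c * t) \<le> 1" if "\<not> c * t < 1"
      using that finite(1) mult_nonneg_nonpos[of m "1 - c * t"] by simp
    then show ?thesis by blast
  qed
  also have "\<dots> \<longleftrightarrow> (1 - 1 / m) / t \<le> c"
    using finite(1) t by (simp add: field_simps)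
  finally show ?thesis unfolding K P by simp
qed

lemma feasible_scale_iff: "feasible_scale M X c \<longleftrightarrow> 0 \<le> c \<and> (SUP t\<in>{0<..}. Psi t) \<le> ereal c"
proof (cases "0 \<le> c")
  case c: True
  have 0: "cumulant M X 0 \<le> ereal (V * 0\<^sup>2 / (2 * (1 - c * 0)))" by (simp add: cumulant_eq zero_ennreal.rep_eq)
  have "feasible_scale M X c \<longleftrightarrow> (\<forall>t\<ge>0. c * t < 1 \<longrightarrow> cumulant M X t \<le> ereal (V * t\<^sup>2 / (2 * (1 - c * t))))"
    using c by (auto simp: feasible_scale_def variance less_one_divide_ereal_iff)
  also have "\<dots> \<longleftrightarrow> (\<forall>t>0. c * t < 1 \<longrightarrow> cumulant M X t \<le> ereal (V * t\<^sup>2 / (2 * (1 - c * t))))"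
    using 0 by (metis less_eq_real_def)
  also have "\<dots> \<longleftrightarrow> (\<forall>t>0. Psi t \<le> ereal c)" using cumulant_le_iff_Psi_le c by auto
  finally show ?thesis using c by (auto simp: SUP_le_iff)
qed (simp add: feasible_scale_def)

text \<open>By \<open>feasible_scale_iff\<close> the feasible scales form a closed half-line, so a
  finite infimum belongs to it.\<close>

lemma feasible_scale_max:
  assumes "max 0 (SUP t\<in>{0<..}. Psi t) < \<infinity>"
  shows "feasible_scale M X (real_of_ereal (max 0 (SUP t\<in>{0<..}. Psi t)))"
proof -
  let ?c = "max 0 (SUP t\<in>{0<..}. Psi t)"
  have "ereal (real_of_ereal ?c) = ?c" using assms
    by (intro ereal_real') (metis abs_ereal_ge0 less_irrefl max.cobounded1)
  moreover have "0 \<le> real_of_ereal ?c" by (simp add: real_of_ereal_pos)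
  ultimately show ?thesis unfolding feasible_scale_iff by (metis max.cobounded2)
qed

theorem c_plus_eq: "c_plus M X = max 0 (SUP t\<in>{0<..}. Psi t)"
proof (rule antisym)
  show "max 0 (SUP t\<in>{0<..}. Psi t) \<le> c_plus M X"
    unfolding c_plus_def by (intro Inf_greatest) (auto simp: feasible_scale_iff)
  show "c_plus M X \<le> max 0 (SUP t\<in>{0<..}. Psi t)"
  proof (cases "max 0 (SUP t\<in>{0<..}. Psi t) < \<infinity>")
    case True
    have "c_plus M X \<le> ereal (real_of_ereal (max 0 (SUP t\<in>{0<..}. Psi t)))"
      unfolding c_plus_def using feasible_scale_max[OF True] by (intro Inf_lower) auto
    also have "\<dots> = max 0 (SUP t\<in>{0<..}. Psi t)" using True
      by (intro ereal_real') (metis abs_ereal_ge0 less_irrefl max.cobounded1)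
    finally show ?thesis .
  qed (metis ereal_infty_less(1) ereal_less_eq(1) less_top top_ereal_def)
qed

text \<open>For t >= t0 the trivial bound 1/t suffices. For t < t0 convexity of the exponential
  gives m - 1 <= (t/t0) (m0 - 1), which controls the quotient near t = 0, where 1/t is
  useless.\<close>

lemma Psi_le_of_finite:
  assumes t0: "0 < t0" and m0: "mgf R g t0 = ereal m0" and t: "0 < t"
  shows "Psi t \<le> ereal (max (1 / t0) ((m0 - 1) / t0))"
proof (cases t rule: mgf_cases)
  case infinite
  have le: "t0 \<ge> t \<Longrightarrow> False"
  proof -
    assume le: "t \<le> t0"
    \<comment> \<open>Finiteness at t0 carries over to smaller arguments, so an infinite moment
      forces t > t0.\<close>
    have "exp (t * x) \<le> 1 + exp (t0 * x)" for x
    proof (cases "0 \<le> x")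
      case True then show ?thesis using le by (simp add: mult_right_mono add_increasing)
    next
      case False then have "exp (t * x) \<le> 1" using t by (simp add: mult_le_0_iff)
      then show ?thesis by (simp add: add_increasing2)
    qed
    then have "(\<integral>\<^sup>+r. ennreal (exp (t * g r)) \<partial>R) \<le> (\<integral>\<^sup>+r. ennreal (1 + exp (t0 * g r)) \<partial>R)"
      by (intro nn_integral_mono ennreal_leI) auto
    also have "\<dots> = 1 + (\<integral>\<^sup>+r. ennreal (exp (t0 * g r)) \<partial>R)"
      using R.emeasure_space_1 by (simp add: nn_integral_add)
    also have "\<dots> < \<infinity>" using m0 by (cases t0 rule: mgf_cases) auto
    finally show False using infinite by simp
  qed
  have "Psi t = ereal (1 / t)" using infinite t by (simp add: Psi_def one_ereal_def)
  moreover have "1 / t \<le> 1 / t0" using le t t0 by (cases "t \<le> t0") (auto simp: frac_le)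
  ultimately show ?thesis by (simp add: max_def)
next
  case (finite m)
  have "1 / ereal m = ereal (1 / m)" using finite by (simp add: one_ereal_def)
  then have P: "Psi t = ereal ((1 - 1 / m) / t)" using finite t by (simp add: Psi_def one_ereal_def)
  show ?thesis
  proof (cases "t0 \<le> t")
    case True
    have "(1 - 1 / m) / t \<le> 1 / t" using finite t by (simp add: divide_right_mono)
    also have "\<dots> \<le> 1 / t0" using True t0 by (simp add: frac_le)
    finally show ?thesis unfolding P by (simp add: le_max_iff_disj)
  next
    case False
    define l where "l = t / t0"
    have l: "0 < l" "l < 1" "t = l * t0" using False t t0 by (auto simp: l_def)
    have m0': "0 < m0" "(\<integral>\<^sup>+r. ennreal (exp (t0 * g r)) \<partial>R) = ennreal m0"
      using m0 by (cases t0 rule: mgf_cases; auto)+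
    have cvx: "exp (t * x) \<le> (1 - l) + l * exp (t0 * x)" for x
      using convex_onD[OF exp_convex, of l 0 "t0 * x"] l by (simp add: mult.assoc)
    have "ennreal m \<le> (\<integral>\<^sup>+r. ennreal ((1 - l) + l * exp (t0 * g r)) \<partial>R)"
      unfolding finite(3)[symmetric] using cvx by (intro nn_integral_mono ennreal_leI) auto
    also have "\<dots> = ennreal (1 - l) + ennreal l * ennreal m0"
      using l R.emeasure_space_1 m0' by (simp add: nn_integral_add ennreal_mult' nn_integral_cmult)
    also have "\<dots> = ennreal (1 - l + l * m0)" using l m0' by (simp add: ennreal_mult')
    finally have "m \<le> 1 - l + l * m0" using l m0' by (subst (asm) ennreal_le_iff) auto
    \<comment> \<open>The difference of the two sides is (m - 1)^2 / m.\<close>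
    moreover have "1 - 1 / m \<le> m - 1"
    proof -
      have "0 \<le> (m - 1)\<^sup>2 / m" using finite(1) by simp
      also have "(m - 1)\<^sup>2 / m = m - 1 - (1 - 1 / m)" using finite(1) by (simp add: power2_eq_square field_simps)
      finally show ?thesis by simp
    qed
    ultimately have "1 - 1 / m \<le> l * (m0 - 1)" by (simp add: algebra_simps)
    then have "(1 - 1 / m) / t \<le> l * (m0 - 1) / t" using t by (simp add: divide_right_mono)
    also have "\<dots> = (m0 - 1) / t0" using l t t0 by simp
    finally show ?thesis unfolding P by (simp add: le_max_iff_disj)
  qed
qed

theorem c_plus_finite_iff: "c_plus M X < \<infinity> \<longleftrightarrow> 0 < tau_plus M X"
proof
  assume "c_plus M X < \<infinity>"
  then obtain c where "feasible_scale M X c" unfolding c_plus_eq using feasible_scale_max by blast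
  then have c: "0 \<le> c" and le: "Psi t \<le> ereal c" if "0 < t" for t
    using that by (auto simp: feasible_scale_iff SUP_le_iff)
  \<comment> \<open>The shift by 1 gives a positive point with c t < 1 even when c = 0.\<close>
  define t where "t = 1 / (c + 1)"
  have t: "0 < t" "c * t < 1" using c[of 1] by (auto simp: t_def)
  then have "cumulant M X t \<le> ereal (V * t\<^sup>2 / (2 * (1 - c * t)))"
    using cumulant_le_iff_Psi_le[of t c] le[of t] c[of 1] by simp
  also have "\<dots> < \<infinity>" by simp
  finally show "0 < tau_plus M X" using t by (auto simp: tau_plus_pos_iff)
next
  assume "0 < tau_plus M X"
  then obtain t0 where t0: "0 < t0" "mgf R g t0 < \<infinity>"
    unfolding tau_plus_pos_iff using cumulant_finite_iff by blast
  then obtain m0 where m0: "mgf R g t0 = ereal m0" by (cases t0 rule: mgf_cases) auto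
  have "(SUP t\<in>{0<..}. Psi t) \<le> ereal (max (1 / t0) ((m0 - 1) / t0))"
    using Psi_le_of_finite[OF t0(1) m0] by (auto simp: SUP_le_iff)
  also have "\<dots> < \<infinity>" by (simp add: max_def)
  finally show "c_plus M X < \<infinity>" by (simp add: c_plus_eq max_def)
qed

end

section \<open>The remainder law for both signs of the argument, and the conclusion\<close>

context levy_khintchine
begin

lemma prob_space_remainder_law: "prob_space (remainder_law a \<nu>)"
proof -
  interpret beta: prob_space beta_1_2 by (rule prob_space_beta_1_2)
  interpret P: pair_prob_space beta_1_2 "canonical_law a \<nu>" ..
  show ?thesis unfolding remainder_law_def by (intro P.prob_space_distr) measurable
qed

lemma nn_integral_remainder_law:
  assumes [measurable]: "f \<in> borel_measurable borel"
  shows "(\<integral>\<^sup>+r. f r \<partial>remainder_law a \<nu>) = (\<integral>\<^sup>+y. \<integral>\<^sup>+b. f (b * y) \<partial>beta_1_2 \<partial>canonical_law a \<nu>)"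
proof -
  interpret beta: prob_space beta_1_2 by (rule prob_space_beta_1_2)
  interpret P: pair_sigma_finite beta_1_2 "canonical_law a \<nu>" ..
  have "(\<integral>\<^sup>+r. f r \<partial>remainder_law a \<nu>) = (\<integral>\<^sup>+z. f (fst z * snd z) \<partial>(beta_1_2 \<Otimes>\<^sub>M canonical_law a \<nu>))"
    unfolding remainder_law_def by (subst nn_integral_distr) (auto simp: case_prod_beta)
  also have "\<dots> = (\<integral>\<^sup>+y. \<integral>\<^sup>+b. f (b * y) \<partial>beta_1_2 \<partial>canonical_law a \<nu>)"
    by (subst P.nn_integral_snd[symmetric]) (auto simp: case_prod_beta)
  finally show ?thesis .
qed

text \<open>For negative t the formula for nonnegative arguments is applied to the reflected laws at
  -t. This spares a separate computation of the Levy characteristics of -X.\<close>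

theorem mgf_remainder:
  "(\<integral>\<^sup>+x. ennreal (exp (t * x)) \<partial>N) =
    (let K = ennreal (V * t\<^sup>2 / 2) * (\<integral>\<^sup>+r. ennreal (exp (t * r)) \<partial>remainder_law a \<nu>)
     in if K = \<infinity> then \<infinity> else ennreal (exp (enn2real K)))"
proof (cases "0 \<le> t")
  case True
  have "cgf t = ennreal (V * t\<^sup>2 / 2) * (\<integral>\<^sup>+r. ennreal (exp (t * r)) \<partial>remainder_law a \<nu>)"
    unfolding cgf_eq_remainder[OF True] by (subst nn_integral_remainder_law) auto
  then show ?thesis using mgf_eq_exp_cgf[OF True] by (simp only: Let_def)
next
  case False
  then have t: "0 \<le> - t" by simp
  interpret beta: prob_space beta_1_2 by (rule prob_space_beta_1_2)
  interpret r: zero_bias "distr N borel uminus" "distr (canonical_law a \<nu>) borel uminus" V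
    by (rule reflected)
  note mN = uminus_measurable[OF sets_N] and m\<kappa> = uminus_measurable[OF sets_canonical_law]
  have "r.cgf (- t) = ennreal (V * t\<^sup>2 / 2) * (\<integral>\<^sup>+y. \<integral>\<^sup>+b. ennreal (exp (t * (b * y))) \<partial>beta_1_2 \<partial>canonical_law a \<nu>)"
    unfolding r.cgf_eq_remainder[OF t] by (subst nn_integral_distr[OF m\<kappa>]) auto
  also have "\<dots> = ennreal (V * t\<^sup>2 / 2) * (\<integral>\<^sup>+r. ennreal (exp (t * r)) \<partial>remainder_law a \<nu>)"
    by (subst nn_integral_remainder_law) auto
  finally have "r.cgf (- t) = ennreal (V * t\<^sup>2 / 2) * (\<integral>\<^sup>+r. ennreal (exp (t * r)) \<partial>remainder_law a \<nu>)" .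
  moreover have "(\<integral>\<^sup>+x. ennreal (exp (- t * x)) \<partial>distr N borel uminus) = (\<integral>\<^sup>+x. ennreal (exp (t * x)) \<partial>N)"
    by (subst nn_integral_distr[OF mN]) auto
  ultimately show ?thesis using r.mgf_eq_exp_cgf[OF t] by (simp only: Let_def)
qed

end

theorem theorem3p1:
  fixes M :: "'a measure" and X :: "'a \<Rightarrow> real" and a :: real and \<nu> :: "real measure"
  assumes "prob_space M"
    and "X \<in> borel_measurable M"
    and "infinitely_divisible M X"
    and "integrable M (\<lambda>\<omega>. (X \<omega>)\<^sup>2)"
    and "prob_space.expectation M X = 0"
    and "prob_space.variance M X > 0"
    and "levy_characteristics M X a \<nu>"
  shows "c_plus M X = max 0 (SUP t\<in>{0<..}. Psi_plus a \<nu> t) \<and>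
    c_minus M X = max 0 (SUP t\<in>{0<..}. Psi_minus a \<nu> t) \<and>
    (max 0 (SUP t\<in>{0<..}. Psi_plus a \<nu> t) < \<infinity> \<longrightarrow>
       feasible_scale M X (real_of_ereal (max 0 (SUP t\<in>{0<..}. Psi_plus a \<nu> t)))) \<and>
    (max 0 (SUP t\<in>{0<..}. Psi_minus a \<nu> t) < \<infinity> \<longrightarrow>
       feasible_scale M (\<lambda>\<omega>. - X \<omega>)
         (real_of_ereal (max 0 (SUP t\<in>{0<..}. Psi_minus a \<nu> t)))) \<and>
    (c_plus M X < \<infinity> \<longleftrightarrow> tau_plus M X > 0) \<and>
    (c_minus M X < \<infinity> \<longleftrightarrow> tau_minus M X > 0)"
proof -
  interpret M: prob_space M by fact
  note [measurable] = \<open>X \<in> borel_measurable M\<close>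
  define V where "V = M.variance X"
  have V: "V = M.expectation (\<lambda>\<omega>. (X \<omega>)\<^sup>2)" unfolding V_def using assms(5) by simp
  obtain b where b: "\<And>u. char (distr M borel X) u =
      exp (\<i> * of_real (b * u) - of_real (a * u\<^sup>2 / 2) +
        (CLINT x|\<nu>. exp (\<i> * of_real (u * x)) - 1 - \<i> * of_real (u * x) * indicator {-1..1} x))"
    using assms(7) unfolding levy_characteristics_def by blast
  interpret levy_khintchine "distr M borel X" \<nu> a b V
  proof (intro levy_khintchine.intro levy_khintchine_axioms.intro)
    show "real_distribution (distr M borel X)" by (rule M.real_distribution_distr) measurable
    show "0 \<le> a" "sets \<nu> = sets borel" "(\<integral>\<^sup>+ x. ennreal (min 1 (x\<^sup>2)) \<partial>\<nu>) < \<infinity>"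
      using assms(7) by (auto simp: levy_characteristics_def)
    show "V = (\<integral>x. x\<^sup>2 \<partial>distr M borel X)" unfolding V by (subst integral_distr) auto
    show "integrable (distr M borel X) (\<lambda>x. x\<^sup>2)" using assms(4) by (simp add: integrable_distr_eq)
    show "(\<integral>x. x \<partial>distr M borel X) = 0" using assms(5) by (simp add: integral_distr)
    show "0 < V" unfolding V_def by fact
  qed (rule b)
  have formula: "(\<integral>\<^sup>+\<omega>. ennreal (exp (t * X \<omega>)) \<partial>M) =
    (let K = ennreal (V * t\<^sup>2 / 2) * (\<integral>\<^sup>+r. ennreal (exp (t * r)) \<partial>remainder_law a \<nu>)
     in if K = \<infinity> then \<infinity> else ennreal (exp (enn2real K)))" for t
    using mgf_remainder[of t] by (simp add: nn_integral_distr)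
  have [measurable]: "(\<lambda>r. r) \<in> borel_measurable (remainder_law a \<nu>)" by (simp add: remainder_law_def)
  interpret plus: remainder_formula M X "remainder_law a \<nu>" "\<lambda>r. r" V
  proof (rule remainder_formula.intro)
    show "M.variance X = V" by (simp only: V_def)
  qed (rule formula \<open>prob_space M\<close> prob_space_remainder_law V_pos \<open>(\<lambda>r. r) \<in> borel_measurable (remainder_law a \<nu>)\<close>)+
  \<comment> \<open>The remainder of -X is distributed as the negative of that of X, so the same law
    is used with r \<mapsto> -r; the formula needed is the one already known, at -t.\<close>
  interpret minus: remainder_formula M "\<lambda>\<omega>. - X \<omega>" "remainder_law a \<nu>" "\<lambda>r. - r" V
  proof (rule remainder_formula.intro)
    show "M.variance (\<lambda>\<omega>. - X \<omega>) = V" unfolding V using assms(5) by simp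
    show "(\<lambda>r. - r) \<in> borel_measurable (remainder_law a \<nu>)" by measurable
    show "(\<integral>\<^sup>+\<omega>. ennreal (exp (t * - X \<omega>)) \<partial>M) =
      (let K = ennreal (V * t\<^sup>2 / 2) * (\<integral>\<^sup>+r. ennreal (exp (t * - r)) \<partial>remainder_law a \<nu>)
       in if K = \<infinity> then \<infinity> else ennreal (exp (enn2real K)))" for t
      using formula[of "- t"] by simp
  qed (fact \<open>prob_space M\<close> prob_space_remainder_law V_pos)+
  have Psi: "plus.Psi = Psi_plus a \<nu>" "minus.Psi = Psi_minus a \<nu>"
    by (intro ext; simp add: plus.Psi_def minus.Psi_def Psi_plus_def Psi_minus_def mgf_def)+
  show ?thesis
    unfolding c_minus_def tau_minus_def
    using plus.c_plus_eq[unfolded Psi] plus.feasible_scale_max[unfolded Psi] plus.c_plus_finite_iff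
      minus.c_plus_eq[unfolded Psi] minus.feasible_scale_max[unfolded Psi] minus.c_plus_finite_iff
    by (intro conjI impI)
qed

end
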